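(* For each of the Borda, Copeland, and Maximin voting protocols, the decision problem DCWM (destructive coalitional weighted manipulation) is in $\mathcal{P}$.
   Context: An election consists of $m$ candidates, $n$ voters each casting a vote (a total order on the candidates), and a winner determination function given by the voting protocol. Neither $m$ nor $n$ is bounded. Voters have nonnegative integer weights, encoded in binary; a vote of weight $k$ is interpreted as $k$ identical unweighted votes. DCWM (for a given protocol): given a set $S$ of weighted votes, the weights for a set $T$ of votes that are still open, and a candidate $h$, decide whether the votes in $T$ can be cast so that $h$ does not win the election determined by the votes in $S\cup T$. In each of the following protocols the candidate with the most points wins. - Borda: for each (unweighted) vote, a candidate receives $m-1$ points if ranked first, $m-2$ if ranked second, $\dots$, $0$ if ranked last. - Copeland: for each pair of candidates, a candidate wins the pairwise election if it is preferred over the other by more than half of the votes (a draw if neither is); a candidate gets $1$ point for each opponent it defeats, $0$ for each draw, and $-1$ for each loss. - Maximin: a candidate's score in a pairwise election is the number of votes that prefer it over the opponent; its number of points is the lowest score it gets in any pairwise election. Ties for the most points are broken adversarially to the manipulators: $h$ counts as not winning only if some other candidate has strictly more points than $h$. *)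

theory Defs
  imports "HOL-Computational_Algebra.Polynomial"
begin

section \<open>Polynomial time\<close>

text \<open>
  Deterministic multi-tape Turing machines. Tapes are infinite in both directions.
  Tape symbols are the numbers below \<open>symbols M\<close>, where 0 is the blank and 1, 2 represent
  the input bits 0, 1. States are the numbers below \<open>states M\<close>, where 0 is the initial state
  and 1, 2 are the (halting) accepting and rejecting states.
\<close>

datatype move = MoveLeft | MoveNone | MoveRight

record turing_machine =
  tapes :: nat
  states :: nat
  symbols :: nat
  delta :: "nat \<Rightarrow> nat list \<Rightarrow> nat \<times> (nat \<times> move) list"

definition wf_tm :: "turing_machine \<Rightarrow> bool" where
  "wf_tm M \<longleftrightarrow> tapes M \<ge> 1 \<and> states M \<ge> 3 \<and> symbols M \<ge> 3 \<and>
     (\<forall>q < states M. \<forall>xs. length xs = tapes M \<and> set xs \<subseteq> {..<symbols M} \<longrightarrow>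
        fst (delta M q xs) < states M \<and>
        length (snd (delta M q xs)) = tapes M \<and>
        fst ` set (snd (delta M q xs)) \<subseteq> {..<symbols M})"

type_synonym tape = "(int \<Rightarrow> nat) \<times> int"  \<comment> \<open>contents and head position\<close>
type_synonym config = "nat \<times> tape list"

fun offset :: "move \<Rightarrow> int" where
  "offset MoveLeft = -1"
| "offset MoveNone = 0"
| "offset MoveRight = 1"

definition read :: "tape \<Rightarrow> nat" where
  "read t = fst t (snd t)"

definition act :: "tape \<Rightarrow> nat \<times> move \<Rightarrow> tape" where
  "act t a = ((fst t)(snd t := fst a), snd t + offset (snd a))"

definition step :: "turing_machine \<Rightarrow> config \<Rightarrow> config" where
  "step M c =
     (if fst c \<in> {1, 2} then c
      else let r = delta M (fst c) (map read (snd c))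
           in (fst r, map2 act (snd c) (snd r)))"

definition input_tape :: "bool list \<Rightarrow> tape" where
  "input_tape x =
     ((\<lambda>i. if 0 \<le> i \<and> i < int (length x) then (if x ! nat i then 2 else 1) else 0), 0)"

definition blank_tape :: tape where
  "blank_tape = ((\<lambda>_. 0), 0)"

definition init :: "turing_machine \<Rightarrow> bool list \<Rightarrow> config" where
  "init M x = (0, input_tape x # replicate (tapes M - 1) blank_tape)"

definition decides_in_time :: "turing_machine \<Rightarrow> bool list set \<Rightarrow> (nat \<Rightarrow> nat) \<Rightarrow> bool" where
  "decides_in_time M L t \<longleftrightarrow>
     (\<forall>x. \<exists>n \<le> t (length x). fst ((step M ^^ n) (init M x)) = (if x \<in> L then 1 else 2))"

definition class_P :: "bool list set set" where
  "class_P = {L. \<exists>M (p :: nat poly). wf_tm M \<and> decides_in_time M L (poly p)}"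


section \<open>Elections\<close>

text \<open>
  A vote lists the candidates from the most to the least preferred one.
  A protocol assigns points, given the set of candidates and the unweighted votes.
\<close>

type_synonym cand = nat
type_synonym vote = "cand list"
type_synonym protocol = "cand set \<Rightarrow> vote list \<Rightarrow> cand \<Rightarrow> int"

definition is_vote :: "cand set \<Rightarrow> vote \<Rightarrow> bool" where
  "is_vote C v \<longleftrightarrow> distinct v \<and> set v = C"

definition position :: "vote \<Rightarrow> cand \<Rightarrow> nat" where
  "position v c = length (takeWhile (\<lambda>x. x \<noteq> c) v)"

definition prefers :: "vote \<Rightarrow> cand \<Rightarrow> cand \<Rightarrow> bool" where
  "prefers v c d \<longleftrightarrow> position v c < position v d"

definition support :: "vote list \<Rightarrow> cand \<Rightarrow> cand \<Rightarrow> nat" where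
  "support V c d = length (filter (\<lambda>v. prefers v c d) V)"

definition defeats :: "vote list \<Rightarrow> cand \<Rightarrow> cand \<Rightarrow> bool" where
  "defeats V c d \<longleftrightarrow> 2 * support V c d > length V"

definition borda :: protocol where
  "borda C V c = (\<Sum>v\<leftarrow>V. int (card C) - 1 - int (position v c))"

definition copeland :: protocol where
  "copeland C V c =
     (\<Sum>d \<in> C - {c}. if defeats V c d then 1 else if defeats V d c then - 1 else 0)"

text \<open>
  With a single candidate the minimum below is over the empty set, hence unspecified.
  This is harmless, as points are only ever compared between different candidates.
\<close>

definition maximin :: protocol where
  "maximin C V c = int (Min ((\<lambda>d. support V c d) ` (C - {c})))"

definition wins :: "protocol \<Rightarrow> cand set \<Rightarrow> vote list \<Rightarrow> cand \<Rightarrow> bool" where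
  "wins score C V h \<longleftrightarrow> \<not> (\<exists>c \<in> C. c \<noteq> h \<and> score C V c > score C V h)"

definition unweighted :: "(vote \<times> nat) list \<Rightarrow> vote list" where
  "unweighted W = concat (map (\<lambda>(v, k). replicate k v) W)"


section \<open>Destructive coalitional weighted manipulation\<close>

record dcwm_instance =
  cands :: "cand list"
  cast_votes :: "(vote \<times> nat) list"
  open_weights :: "nat list"
  target :: cand

definition wf_instance :: "dcwm_instance \<Rightarrow> bool" where
  "wf_instance I \<longleftrightarrow>
     distinct (cands I) \<and> target I \<in> set (cands I) \<and>
     (\<forall>(v, k) \<in> set (cast_votes I). is_vote (set (cands I)) v)"

definition manipulable :: "protocol \<Rightarrow> dcwm_instance \<Rightarrow> bool" where
  "manipulable score I \<longleftrightarrow>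
     (\<exists>vs. length vs = length (open_weights I) \<and>
           (\<forall>v \<in> set vs. is_vote (set (cands I)) v) \<and>
           \<not> wins score (set (cands I))
                (unweighted (cast_votes I @ zip vs (open_weights I))) (target I))"

text \<open>
  Instances as bit strings. Numbers (names of candidates and weights) are written in binary,
  least significant bit first. Lists are made self-delimiting: a 1 precedes each
  element and a 0 marks the end.
\<close>

fun bits :: "nat \<Rightarrow> bool list" where
  "bits n = (if n = 0 then [] else odd n # bits (n div 2))"

declare bits.simps [simp del]

definition enc_list :: "('a \<Rightarrow> bool list) \<Rightarrow> 'a list \<Rightarrow> bool list" where
  "enc_list f xs = concat (map (\<lambda>x. True # f x) xs) @ [False]"

definition enc_nat :: "nat \<Rightarrow> bool list" where
  "enc_nat n = enc_list (\<lambda>b. [b]) (bits n)"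

definition enc_weighted_vote :: "vote \<times> nat \<Rightarrow> bool list" where
  "enc_weighted_vote vk = enc_list enc_nat (fst vk) @ enc_nat (snd vk)"

definition enc_instance :: "dcwm_instance \<Rightarrow> bool list" where
  "enc_instance I =
     enc_list enc_nat (cands I) @ enc_list enc_weighted_vote (cast_votes I) @
     enc_list enc_nat (open_weights I) @ enc_nat (target I)"

definition DCWM :: "protocol \<Rightarrow> bool list set" where
  "DCWM score = enc_instance ` {I. wf_instance I \<and> manipulable score I}"

definition prefix_code :: "('a \<Rightarrow> bool list) \<Rightarrow> bool" where
  "prefix_code f \<longleftrightarrow> (\<forall>x y r s. f x @ r = f y @ s \<longrightarrow> x = y \<and> r = s)"

lemma prefix_codeD: "prefix_code f \<Longrightarrow> f x @ r = f y @ s \<Longrightarrow> x = y \<and> r = s"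
  unfolding prefix_code_def by blast

lemma prefix_code_enc_list:
  assumes "prefix_code f"
  shows "prefix_code (enc_list f)"
proof -
  have "enc_list f xs @ r = enc_list f ys @ s \<Longrightarrow> xs = ys \<and> r = s" for xs ys r s
  proof (induction xs arbitrary: ys)
    case Nil
    then show ?case by (cases ys) (auto simp: enc_list_def)
  next
    case (Cons x xs)
    show ?case
    proof (cases ys)
      case Nil
      with Cons.prems show ?thesis by (simp add: enc_list_def)
    next
      case (Cons y ys')
      with Cons.prems have "f x @ (enc_list f xs @ r) = f y @ (enc_list f ys' @ s)"
        by (simp add: enc_list_def)
      from prefix_codeD[OF assms this] Cons.IH[of ys'] Cons show ?thesis by simp
    qed
  qed
  then show ?thesis unfolding prefix_code_def by blast
qed

lemma inj_bits: "bits m = bits n \<Longrightarrow> m = n"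
proof (induction m arbitrary: n rule: less_induct)
  case (less m)
  show ?case
  proof (cases "m = 0 \<or> n = 0")
    case True
    with less.prems show ?thesis
      by (metis bits.simps list.distinct(1))
  next
    case False
    with less.prems have "odd m = odd n" "bits (m div 2) = bits (n div 2)"
      by (simp_all add: bits.simps[of m] bits.simps[of n])
    moreover from this False less.IH[of "m div 2" "n div 2"] have "m div 2 = n div 2" by simp
    ultimately show ?thesis by (metis odd_two_times_div_two_succ even_two_times_div_two)
  qed
qed

lemma prefix_code_enc_nat: "prefix_code enc_nat"
proof -
  have "prefix_code (\<lambda>b :: bool. [b])" unfolding prefix_code_def by simp
  from prefix_code_enc_list[OF this] show ?thesis
    unfolding prefix_code_def enc_nat_def by (blast dest: inj_bits)
qed

lemma prefix_code_enc_weighted_vote: "prefix_code enc_weighted_vote"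
  unfolding prefix_code_def enc_weighted_vote_def
  using prefix_codeD[OF prefix_code_enc_nat]
    prefix_codeD[OF prefix_code_enc_list[OF prefix_code_enc_nat]]
  by (metis append.assoc prod_eqI)

lemma inj_enc_instance: "inj enc_instance"
proof (rule injI)
  fix I J assume eq: "enc_instance I = enc_instance J"
  note nats = prefix_codeD[OF prefix_code_enc_list[OF prefix_code_enc_nat]]
  have c: "cands I = cands J" and
    1: "enc_list enc_weighted_vote (cast_votes I) @ enc_list enc_nat (open_weights I) @ enc_nat (target I)
      = enc_list enc_weighted_vote (cast_votes J) @ enc_list enc_nat (open_weights J) @ enc_nat (target J)"
    using nats[OF eq[unfolded enc_instance_def]] by auto
  note 2 = prefix_codeD[OF prefix_code_enc_list[OF prefix_code_enc_weighted_vote] 1]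
  note 3 = nats[OF conjunct2[OF 2]]
  have "target I = target J"
    using prefix_codeD[OF prefix_code_enc_nat, of "target I" "[]" "target J" "[]"] 3 by simp
  with c 2 3 show "I = J" by simp
qed

end

(*
  A coalition that wants some c to get strictly more points than h does best by letting every
  manipulator rank c first and h last: this improves every pairwise result of c and worsens
  every one of h, and all three point counts are monotone in the pairwise supports (for Borda
  because the points of c are the sum of its supports against all opponents). So it is enough
  to try each c, and the supports are sums of binary weights.

  For the time bound, Turing machines are treated as machines with four stacks. Data are trees
  in prefix notation; since a prefix code can be read off the top of a stack, a program can
  replace the topmost tree by its image and leave everything below untouched. This makes the
  functions computed in polynomial time closed under composition, pairing, case distinction and
  folds over lists whose accumulator grows additively.
*)
theory Submission
  imports Defs
begin

section \<open>Stack programs\<close>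

text \<open>Membership in \<open>class_P\<close> asks for one concrete machine that answers
  correctly on every bit string, so rejecting strings that encode no instance belongs to the
  algorithm, and parsing needs a time bound of its own. A time bound for a single step does not
  survive iteration: a step that doubles its argument is cheap, but repeating it gives exponential
  size. Hence the size of accumulators has to be controlled, and additive growth is a condition that
  can be checked for one step at a time. Weights are binary, so the list of unweighted votes may be
  exponentially long. It occurs only in the specification; the algorithm works with supports. Of the
  four stacks one holds the data and one counts subtrees that are still to be read. Reading a tree
  removes it, so duplication needs two further stacks that each receive a copy. The symbol 3, which
  occurs in no tree, separates what is set aside from what lies below.\<close>

text \<open>
  A stack occupies the cells from the head to the right, so the input tape is a stack already.
  \<open>Blank\<close> moves the head to the left, which pushes a blank, and \<open>Put\<close> overwrites the top.
\<close>

datatype cmd =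
    Blank nat
  | Put nat nat
  | Drop nat
  | Seq cmd cmd (infixr ";;" 60)
  | Cond nat "nat \<Rightarrow> bool" cmd cmd
  | Loop nat "nat \<Rightarrow> bool" cmd

type_synonym store = "nat \<Rightarrow> nat list"

text \<open>The value 0 is the blank: below its last entry a stack consists of blank cells, and the
  end of the input is recognised by reading one.\<close>

fun peek :: "nat list \<Rightarrow> nat" where
  "peek [] = 0"
| "peek (a # l) = a"

text \<open>The topmost symbols enter as a function \<open>x\<close>, so that the same equations
  serve the stacks, where \<open>x\<close> is given by \<open>peek\<close>, and the transition
  function of the machine, where it gives the scanned symbols.\<close>

fun next_cont :: "cmd \<Rightarrow> cmd list \<Rightarrow> (nat \<Rightarrow> nat) \<Rightarrow> cmd list" where
  "next_cont (a ;; b) k x = a # b # k"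
| "next_cont (Cond i P a b) k x = (if P (x i) then a else b) # k"
| "next_cont (Loop i P a) k x = (if P (x i) then a # Loop i P a # k else k)"
| "next_cont c k x = k"

fun effect :: "cmd \<Rightarrow> store \<Rightarrow> store" where
  "effect (Blank i) s = s(i := 0 # s i)"
| "effect (Put i a) s = s(i := a # tl (s i))"
| "effect (Drop i) s = s(i := tl (s i))"
| "effect c s = s"

fun sstep :: "cmd list \<times> store \<Rightarrow> cmd list \<times> store" where
  "sstep ([], s) = ([], s)"
| "sstep (c # k, s) = (next_cont c k (\<lambda>i. peek (s i)), effect c s)"

fun ok :: "cmd \<Rightarrow> bool" where
  "ok (Blank i) \<longleftrightarrow> i < 4"
| "ok (Put i a) \<longleftrightarrow> i < 4 \<and> a < 4"
| "ok (Drop i) \<longleftrightarrow> i < 4"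
| "ok (a ;; b) \<longleftrightarrow> ok a \<and> ok b"
| "ok (Cond i P a b) \<longleftrightarrow> i < 4 \<and> ok a \<and> ok b"
| "ok (Loop i P a) \<longleftrightarrow> i < 4 \<and> ok a"

text \<open>
  The control states of the Turing machine are the lists of commands that remain to be executed;
  \<open>conts c k\<close> contains those that occur while \<open>c\<close> is running in front of \<open>k\<close>.
\<close>

fun conts :: "cmd \<Rightarrow> cmd list \<Rightarrow> cmd list set" where
  "conts (a ;; b) k = insert ((a ;; b) # k) (conts a (b # k) \<union> conts b k)"
| "conts (Cond i P a b) k = insert (Cond i P a b # k) (conts a k \<union> conts b k)"
| "conts (Loop i P a) k = insert (Loop i P a # k) (conts a (Loop i P a # k))"
| "conts c k = {c # k}"

lemma finite_conts: "finite (conts c k)"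
  by (induction c arbitrary: k) auto

lemma conts_self: "c # k \<in> conts c k"
  by (cases c) auto

text \<open>Leaving \<open>c\<close> leads to \<open>k\<close>, hence the \<open>insert\<close>. A
  loop puts itself, and nothing longer, behind its body, so continuation lists do not keep growing:
  this is why finitely many control states suffice.\<close>

lemma conts_closed: "c' # k' \<in> conts c k \<Longrightarrow> next_cont c' k' x \<in> insert k (conts c k)"
proof (induction c arbitrary: k)
  case (Seq a b)
  show ?case
    using Seq.prems conts_self[of a "b # k"] conts_self[of b k] Seq.IH(1)[of "b # k"] Seq.IH(2)[of k] by auto
next
  case (Cond i P a b)
  show ?case
    using Cond.prems conts_self[of a k] conts_self[of b k] Cond.IH(1)[of k] Cond.IH(2)[of k] by auto
next
  case (Loop i P a)
  show ?case
    using Loop.prems conts_self[of a "Loop i P a # k"] Loop.IH[of "Loop i P a # k"]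
    by (cases "P (x i)") auto
qed auto

lemma conts_ok: "l \<in> conts c k \<Longrightarrow> ok c \<Longrightarrow> list_all ok k \<Longrightarrow> list_all ok l"
  by (induction c arbitrary: k) fastforce+


section \<open>Simulation of stack programs by Turing machines\<close>

text \<open>All cells to the left of the head have to be blank, so that moving left pushes a blank.
  Trailing zeros of the list are invisible on the tape, so the tape does not determine the
  list.\<close>

definition represents :: "tape \<Rightarrow> nat list \<Rightarrow> bool" where
  "represents t l \<longleftrightarrow>
     (\<forall>j. fst t (snd t + j) = (if 0 \<le> j \<and> nat j < length l then l ! nat j else 0))"

text \<open>\<open>Drop\<close> erases the cell before moving right; otherwise the cells left of the
  head would not stay blank.\<close>

fun tape_action :: "cmd \<Rightarrow> nat \<Rightarrow> nat \<Rightarrow> nat \<times> move" where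
  "tape_action (Blank j) i x = (x, if i = j then MoveLeft else MoveNone)"
| "tape_action (Put j a) i x = (if i = j then a else x, MoveNone)"
| "tape_action (Drop j) i x = (if i = j then (0, MoveRight) else (x, MoveNone))"
| "tape_action c i x = (x, MoveNone)"

lemma represents_read: "represents t l \<Longrightarrow> read t = peek l"
  unfolding represents_def read_def by (cases l) (auto dest: spec[of _ 0])

lemma represents_stay: "represents t l \<Longrightarrow> represents (act t (read t, MoveNone)) l"
  unfolding represents_def act_def read_def by auto

lemma represents_blank:
  assumes "represents t l"
  shows "represents (act t (read t, MoveLeft)) (0 # l)"
proof -
  have "fst t (snd t - 1 + j) = (if 0 \<le> j \<and> nat j < length (0 # l) then (0 # l) ! nat j else 0)" for j
  proof -
    have "fst t (snd t + (j - 1)) = (if 0 \<le> j - 1 \<and> nat (j - 1) < length l then l ! nat (j - 1) else 0)"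
      using assms unfolding represents_def by blast
    moreover have "nat j = (if 0 \<le> j - 1 then Suc (nat (j - 1)) else 0)" by auto
    moreover have "snd t + (j - 1) = snd t - 1 + j" by simp
    ultimately show ?thesis by auto
  qed
  then show ?thesis unfolding represents_def act_def read_def by simp
qed

lemma represents_put:
  assumes "represents t l"
  shows "represents (act t (a, MoveNone)) (a # tl l)"
proof -
  have "((fst t)(snd t := a)) (snd t + j) =
      (if 0 \<le> j \<and> nat j < length (a # tl l) then (a # tl l) ! nat j else 0)" for j
  proof (cases "j = 0")
    case False
    have "fst t (snd t + j) = (if 0 \<le> j \<and> nat j < length l then l ! nat j else 0)"
      using assms unfolding represents_def by blast
    with False show ?thesis by (cases "0 \<le> j"; cases "nat j"; cases l) auto
  qed simp
  then show ?thesis unfolding represents_def act_def by simp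
qed

lemma represents_drop:
  assumes "represents t l"
  shows "represents (act t (0, MoveRight)) (tl l)"
proof -
  have "((fst t)(snd t := 0)) (snd t + 1 + j) =
      (if 0 \<le> j \<and> nat j < length (tl l) then tl l ! nat j else 0)" for j
  proof (cases "j = -1")
    case False
    have "fst t (snd t + (j + 1)) = (if 0 \<le> j + 1 \<and> nat (j + 1) < length l then l ! nat (j + 1) else 0)"
      using assms unfolding represents_def by blast
    moreover have "nat (j + 1) = Suc (nat j)" if "0 \<le> j" using that by simp
    moreover have "snd t + (j + 1) = snd t + 1 + j" by simp
    ultimately show ?thesis using False by (cases "0 \<le> j"; cases l) auto
  qed simp
  then show ?thesis unfolding represents_def act_def by simp
qed

lemma represents_action:
  assumes "represents t (s i)"
  shows "represents (act t (tape_action c i (read t))) (effect c s i)"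
  using represents_stay[OF assms] represents_blank[OF assms] represents_put[OF assms]
    represents_drop[OF assms]
  by (cases c) (auto split: prod.split)

lemma next_cont_cong: "ok c \<Longrightarrow> (\<And>i. i < 4 \<Longrightarrow> x i = y i) \<Longrightarrow> next_cont c k x = next_cont c k y"
  by (cases c) auto

text \<open>\<open>f\<close> numbers the continuation lists. The empty list, a finished program,
  takes one more step into the accepting or rejecting state, according to whether the top of stack 0
  is 2. Numbers outside the range of \<open>f\<close> get an arbitrary legal transition, as
  \<open>wf_tm\<close> constrains \<open>delta\<close> in every state.\<close>

definition machine :: "cmd list set \<Rightarrow> (cmd list \<Rightarrow> nat) \<Rightarrow> nat \<Rightarrow> turing_machine" where
  "machine Q f n = \<lparr>tapes = 4, states = n, symbols = 4, delta = (\<lambda>q xs.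
     if q \<in> f ` Q then
       (case inv_into Q f q of
          [] \<Rightarrow> (if xs ! 0 = 2 then 1 else 2, map (\<lambda>x. (x, MoveNone)) xs)
        | c # k \<Rightarrow> (f (next_cont c k (\<lambda>i. xs ! i)), map (\<lambda>i. tape_action c i (xs ! i)) [0..<4]))
     else (1, map (\<lambda>x. (x, MoveNone)) xs))\<rparr>"

lemma tape_action_symbol: "ok c \<Longrightarrow> x < 4 \<Longrightarrow> fst (tape_action c i x) < 4"
  by (cases c) auto

lemma wf_machine:
  assumes "n \<ge> 3" and f: "\<forall>k \<in> Q. f k < n" "inj_on f Q"
    and closed: "\<And>c k x. c # k \<in> Q \<Longrightarrow> ok c \<and> next_cont c k x \<in> Q"
  shows "wf_tm (machine Q f n)"
proof -
  have "fst (delta (machine Q f n) q xs) < n \<and> length (snd (delta (machine Q f n) q xs)) = 4 \<and>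
      fst ` set (snd (delta (machine Q f n) q xs)) \<subseteq> {..<4}"
    if xs: "length xs = 4" "set xs \<subseteq> {..<4}" for q xs
  proof (cases "q \<in> f ` Q")
    case True
    then obtain k where k: "k \<in> Q" "q = f k" by auto
    with f have [simp]: "inv_into Q f q = k" by simp
    show ?thesis
    proof (cases k)
      case Nil
      with True xs assms(1) show ?thesis by (auto simp: machine_def)
    next
      case (Cons c k')
      have "xs ! i < 4" if "i < 4" for i
        using xs that nth_mem[of i xs] by (metis lessThan_iff subsetD)
      with closed k(1) Cons have "fst (tape_action c i (xs ! i)) < 4" if "i < 4" for i
        using tape_action_symbol that by blast
      moreover have "f (next_cont c k' ((!) xs)) < n" using f closed k(1) Cons by blast
      ultimately show ?thesis using Cons True by (auto simp: machine_def)
    qed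
  next
    case False
    with xs assms(1) show ?thesis by (auto simp: machine_def)
  qed
  with assms(1) show ?thesis unfolding wf_tm_def by (simp add: machine_def)
qed

definition simulates :: "cmd list set \<Rightarrow> (cmd list \<Rightarrow> nat) \<Rightarrow> config \<Rightarrow> cmd list \<times> store \<Rightarrow> bool" where
  "simulates Q f c z \<longleftrightarrow> fst z \<in> Q \<and> fst c = f (fst z) \<and> length (snd c) = 4 \<and>
     (\<forall>i < 4. represents (snd c ! i) (snd z i))"

lemma simulates_step:
  assumes sim: "simulates Q f c z" and ne: "fst z \<noteq> []"
    and f: "inj_on f Q" "\<forall>k \<in> Q. f k \<notin> {1, 2}"
    and closed: "\<And>c k x. c # k \<in> Q \<Longrightarrow> ok c \<and> next_cont c k x \<in> Q"
  shows "simulates Q f (step (machine Q f n) c) (sstep z)"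
proof -
  obtain b k s where z: "z = (b # k, s)" using ne by (cases z) (auto simp: neq_Nil_conv)
  from sim have b: "b # k \<in> Q" "fst c = f (b # k)" "length (snd c) = 4"
    and rep: "\<And>i. i < 4 \<Longrightarrow> represents (snd c ! i) (s i)"
    by (auto simp: simulates_def z)
  let ?xs = "map read (snd c)"
  have xs: "?xs ! i = peek (s i)" if "i < 4" for i
    using rep[OF that] b that by (simp add: represents_read)
  have nc: "next_cont b k ((!) ?xs) = next_cont b k (\<lambda>i. peek (s i))"
    using closed[OF b(1)] xs by (intro next_cont_cong) auto
  have "step (machine Q f n) c =
      (f (next_cont b k ((!) ?xs)), map2 act (snd c) (map (\<lambda>i. tape_action b i (?xs ! i)) [0..<4]))"
  proof -
    have "fst c \<notin> {1, 2}" "inv_into Q f (fst c) = b # k" "fst c \<in> f ` Q" using f b by auto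
    then show ?thesis by (simp add: step_def machine_def)
  qed
  moreover have "represents (map2 act (snd c) (map (\<lambda>i. tape_action b i (?xs ! i)) [0..<4]) ! i) (effect b s i)"
    if "i < 4" for i
    using represents_action[of "snd c ! i" s i b] rep[OF that] that b by simp
  ultimately show ?thesis
    using closed[OF b(1)] b unfolding simulates_def z nc by simp
qed

definition input_store :: "bool list \<Rightarrow> store" where
  "input_store x = (\<lambda>_. [])(0 := map (\<lambda>b. if b then 2 else 1) x)"

lemma class_P_I:
  assumes "ok P"
    and run: "\<And>x. \<exists>t \<le> poly p (length x). \<exists>s. (sstep ^^ t) ([P], input_store x) = ([], s) \<and>
                 (peek (s 0) = 2 \<longleftrightarrow> x \<in> L)"
  shows "L \<in> class_P"
proof -
  define Q where "Q = insert [] (conts P [])"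
  have fin: "finite (Q - {[P]})" unfolding Q_def using finite_conts by simp
  have PQ: "[P] \<in> Q" unfolding Q_def using conts_self by simp
  obtain g where g: "bij_betw g (Q - {[P]}) {0..<card (Q - {[P]})}"
    using ex_bij_betw_finite_nat[OF fin] by blast
  \<comment> \<open>The program itself becomes the initial state 0, and the shift by 3 keeps the
    halting states 1 and 2 free.\<close>
  define f where "f k = (if k = [P] then 0 else g k + 3)" for k
  define n where "n = card (Q - {[P]}) + 3"
  have f: "inj_on f Q" "\<forall>k \<in> Q. f k \<notin> {1, 2}" "\<forall>k \<in> Q. f k < n" "n \<ge> 3" "f [P] = 0"
  proof -
    have g': "inj_on g (Q - {[P]})" "\<And>k. k \<in> Q \<Longrightarrow> k \<noteq> [P] \<Longrightarrow> g k < card (Q - {[P]})"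
      using bij_betw_imp_inj_on[OF g] bij_betw_apply[OF g] by auto
    from g'(1) show "inj_on f Q" unfolding f_def inj_on_def by auto
    from g'(2) show "\<forall>k \<in> Q. f k \<notin> {1, 2}" "\<forall>k \<in> Q. f k < n"
      unfolding f_def n_def by auto
  qed (simp_all add: f_def n_def)
  have closed: "ok c \<and> next_cont c k x \<in> Q" if "c # k \<in> Q" for c k x
    using that conts_closed[of c k P "[]" x] conts_ok[of "c # k" P "[]"] assms(1)
    unfolding Q_def by auto
  let ?M = "machine Q f n"
  note wf = wf_machine[OF f(4,3,1) closed]
  \<comment> \<open>The summand 1 pays for the last step, from the empty list to a halting
    state.\<close>
  have "\<exists>m \<le> poly (p + 1) (length x). fst ((step ?M ^^ m) (init ?M x)) = (if x \<in> L then 1 else 2)" for x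
  proof -
    have blank: "represents blank_tape []" by (simp add: blank_tape_def represents_def)
    have input: "represents (input_tape x) (map (\<lambda>b. if b then 2 else 1) x)"
      by (auto simp: input_tape_def represents_def zless_nat_eq_int_zless nat_less_iff)
    have init: "simulates Q f (init ?M x) ([P], input_store x)"
      using PQ f(5) blank input unfolding simulates_def init_def input_store_def
      by (auto simp: machine_def nth_Cons')
    \<comment> \<open>\<open>sstep\<close> stands still on the empty list, whereas the machine moves
      on to a halting state. So \<open>t\<close> program steps are matched by only
      \<open>m \<le> t\<close> machine steps, those before the program has ended.\<close>
    have sim: "\<exists>m \<le> t. simulates Q f ((step ?M ^^ m) (init ?M x)) ((sstep ^^ t) ([P], input_store x))" for t
    proof (induction t)
      case 0
      with init show ?case by simp
    next
      case (Suc t)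
      then obtain m where m: "m \<le> t"
        "simulates Q f ((step ?M ^^ m) (init ?M x)) ((sstep ^^ t) ([P], input_store x))" by blast
      show ?case
      proof (cases "fst ((sstep ^^ t) ([P], input_store x)) = []")
        case True
        then have "(sstep ^^ Suc t) ([P], input_store x) = (sstep ^^ t) ([P], input_store x)"
          by (cases "(sstep ^^ t) ([P], input_store x)") simp
        with m show ?thesis by (metis le_SucI)
      next
        case False
        from simulates_step[OF m(2) False f(1,2) closed]
        have "simulates Q f ((step ?M ^^ Suc m) (init ?M x)) ((sstep ^^ Suc t) ([P], input_store x))"
          by simp
        with m(1) show ?thesis by blast
      qed
    qed
    obtain t s where t: "t \<le> poly p (length x)" "(sstep ^^ t) ([P], input_store x) = ([], s)"
      and s: "peek (s 0) = 2 \<longleftrightarrow> x \<in> L" using run[of x] by blast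
    obtain m where m: "m \<le> t" "simulates Q f ((step ?M ^^ m) (init ?M x)) ([], s)"
      using sim[of t] t(2) by auto
    define c where "c = (step ?M ^^ m) (init ?M x)"
    have c: "[] \<in> Q" "fst c = f []" "length (snd c) = 4" "represents (snd c ! 0) (s 0)"
      using m(2) unfolding c_def simulates_def by auto
    have "map read (snd c) ! 0 = peek (s 0)" using c by (simp add: represents_read)
    then have "fst (step ?M c) = (if x \<in> L then 1 else 2)"
      using c f(1,2) s by (auto simp: step_def machine_def)
    then have "fst ((step ?M ^^ Suc m) (init ?M x)) = (if x \<in> L then 1 else 2)"
      unfolding c_def by simp
    moreover have "Suc m \<le> poly (p + 1) (length x)" using m(1) t(1) by simp
    ultimately show ?thesis by (intro exI[of _ "Suc m"] conjI)
  qed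
  then have "decides_in_time ?M L (poly (p + 1))" unfolding decides_in_time_def by (rule allI)
  with wf show ?thesis unfolding class_P_def by blast
qed

section \<open>Running time of stack programs\<close>

text \<open>The step count \<open>t\<close> is chosen before the continuation \<open>k\<close>, so a
  run can be placed in front of any further commands. \<open>T\<close> is only an upper bound, which
  allows generous constants.\<close>

definition runs :: "cmd \<Rightarrow> store \<Rightarrow> nat \<Rightarrow> store \<Rightarrow> bool" where
  "runs c s T s' \<longleftrightarrow> (\<exists>t \<le> T. \<forall>k. (sstep ^^ t) (c # k, s) = (k, s'))"

lemma runs_mono: "runs c s T s' \<Longrightarrow> T \<le> T' \<Longrightarrow> runs c s T' s'"
  unfolding runs_def by (meson le_trans)

lemma runs_first:
  assumes "\<And>k. sstep (c # k, s) = (l @ k, s1)"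
    and "\<exists>t \<le> T. \<forall>k. (sstep ^^ t) (l @ k, s1) = (k, s')"
  shows "runs c s (Suc T) s'"
proof -
  obtain t where "t \<le> T" "\<And>k. (sstep ^^ t) (l @ k, s1) = (k, s')" using assms(2) by blast
  then have "Suc t \<le> Suc T" "\<And>k. (sstep ^^ Suc t) (c # k, s) = (k, s')"
    using assms(1) by (simp_all add: funpow_swap1)
  then show ?thesis unfolding runs_def by blast
qed

lemma runs_basic: "(\<And>k x. next_cont c k x = k) \<Longrightarrow> runs c s 1 (effect c s)"
  using runs_first[of c s "[]" "effect c s" 0] by simp

lemma run_two:
  assumes "runs a s m s1" "runs b s1 n s2"
  shows "\<exists>t \<le> m + n. \<forall>k. (sstep ^^ t) (a # b # k, s) = (k, s2)"
proof -
  obtain t1 where t1: "t1 \<le> m" "\<And>k. (sstep ^^ t1) (a # k, s) = (k, s1)"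
    using assms(1) unfolding runs_def by blast
  obtain t2 where t2: "t2 \<le> n" "\<And>k. (sstep ^^ t2) (b # k, s1) = (k, s2)"
    using assms(2) unfolding runs_def by blast
  have "(sstep ^^ (t2 + t1)) (a # b # k, s) = (k, s2)" for k
    using t1(2) t2(2) by (simp add: funpow_add)
  moreover have "t2 + t1 \<le> m + n" using t1(1) t2(1) by simp
  ultimately show ?thesis by blast
qed

lemma runs_Seq: "runs a s m s1 \<Longrightarrow> runs b s1 n s2 \<Longrightarrow> runs (a ;; b) s (Suc (m + n)) s2"
  by (rule runs_first[of _ _ "[a, b]" s]) (auto dest: run_two)

lemma runs_Cond:
  "runs (if P (peek (s i)) then a else b) s m s' \<Longrightarrow> runs (Cond i P a b) s (Suc m) s'"
  by (rule runs_first[of _ _ "[if P (peek (s i)) then a else b]" s]) (simp_all add: runs_def)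

lemma runs_Loop_done: "\<not> P (peek (s i)) \<Longrightarrow> runs (Loop i P a) s 1 s"
  using runs_first[of "Loop i P a" s "[]" s 0] by simp

lemma runs_Loop_step:
  "P (peek (s i)) \<Longrightarrow> runs a s m s1 \<Longrightarrow> runs (Loop i P a) s1 n s2 \<Longrightarrow>
   runs (Loop i P a) s (Suc (m + n)) s2"
  by (rule runs_first[of _ _ "[a, Loop i P a]" s]) (auto dest: run_two)

definition stacks :: "nat list \<Rightarrow> nat list \<Rightarrow> nat list \<Rightarrow> nat list \<Rightarrow> store" where
  "stacks a b c d = (\<lambda>_. [])(0 := a, 1 := b, 2 := c, 3 := d)"

lemma stacks_simps [simp]:
  "stacks a b c d 0 = a" "stacks a b c d (Suc 0) = b" "stacks a b c d 2 = c" "stacks a b c d 3 = d"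
  "(stacks a b c d)(0 := x) = stacks x b c d" "(stacks a b c d)(Suc 0 := x) = stacks a x c d"
  "(stacks a b c d)(2 := x) = stacks a b x d" "(stacks a b c d)(3 := x) = stacks a b c x"
  by (auto simp: stacks_def fun_eq_iff)

lemma runs_Drop: "s' = s(i := tl (s i)) \<Longrightarrow> runs (Drop i) s 1 s'"
  using runs_basic[of "Drop i" s] by simp

definition push :: "nat \<Rightarrow> nat \<Rightarrow> cmd" where
  "push i a = Blank i ;; Put i a"

lemma runs_push: "s' = s(i := a # s i) \<Longrightarrow> runs (push i a) s 3 s'"
  using runs_Seq[OF runs_basic[of "Blank i" s] runs_basic[of "Put i a"]]
  unfolding push_def by (simp add: numeral_3_eq_3)

lemma runs_push_stacks:
  "runs (push 0 x) (stacks a b c d) 3 (stacks (x # a) b c d)"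
  "runs (push 1 x) (stacks a b c d) 3 (stacks a (x # b) c d)"
  "runs (push 2 x) (stacks a b c d) 3 (stacks a b (x # c) d)"
  "runs (push 3 x) (stacks a b c d) 3 (stacks a b c (x # d))"
  by (rule runs_push; simp)+

lemma runs_Drop_stacks:
  "runs (Drop 0) (stacks (x # a) b c d) 1 (stacks a b c d)"
  "runs (Drop 3) (stacks a b c (x # d)) 1 (stacks a b c d)"
  by (rule runs_Drop; simp)+

lemma ok_push [simp]: "ok (push i a) \<longleftrightarrow> i < 4 \<and> a < 4"
  by (auto simp: push_def)


section \<open>Trees on stacks\<close>

datatype tree = Leaf | Node tree tree

fun flatten :: "tree \<Rightarrow> nat list" where
  "flatten Leaf = [1]"
| "flatten (Node a b) = 2 # flatten a @ flatten b"

text \<open>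
  Moves the topmost tree of stack 0, reversed, onto both stacks 1 and 2, above a marker 3.
  Stack 3 counts in unary the trees that are still to be read.
\<close>

definition grab_loop :: cmd where
  "grab_loop = Loop 3 (\<lambda>x. x = 2)
     (Cond 0 (\<lambda>x. x = 2) (push 1 2 ;; push 2 2 ;; push 3 2) (push 1 1 ;; push 2 1 ;; Drop 3) ;; Drop 0)"

text \<open>The 1 placed on stack 3 under the counter stops the loop even if the old contents of
  that stack begin with 2.\<close>

definition grab :: cmd where
  "grab = push 1 3 ;; push 2 3 ;; push 3 1 ;; push 3 2 ;; grab_loop ;; Drop 3"

text \<open>The loop does not stop between the two subtrees of a node, so the claim prolongs a given
  run at its beginning: the run for the second subtree is what the first one is prepended to. A node
  replaces one pending tree by two, a leaf settles one. A round takes at most 15 steps; 20 is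
  generous.\<close>

lemma runs_grab_loop:
  "runs grab_loop (stacks r (rev (flatten t) @ b) (rev (flatten t) @ c) d) T s' \<Longrightarrow>
   runs grab_loop (stacks (flatten t @ r) b c (2 # d)) (T + 20 * length (flatten t)) s'"
proof (induction t arbitrary: r b c d T)
  case Leaf
  have "runs (push 1 1 ;; push 2 1 ;; Drop 3) (stacks (1 # r) b c (2 # d))
      (Suc (3 + Suc (3 + 1))) (stacks (1 # r) (1 # b) (1 # c) d)"
    by (rule runs_Seq[OF runs_push_stacks(2) runs_Seq[OF runs_push_stacks(3) runs_Drop_stacks(2)]])
  then have "runs (Cond 0 (\<lambda>x. x = 2) (push 1 2 ;; push 2 2 ;; push 3 2) (push 1 1 ;; push 2 1 ;; Drop 3))
     (stacks (1 # r) b c (2 # d)) (Suc (Suc (3 + Suc (3 + 1)))) (stacks (1 # r) (1 # b) (1 # c) d)"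
    by (intro runs_Cond) simp
  note 1 = runs_Seq[OF this runs_Drop_stacks(1)]
  have "runs grab_loop (stacks (1 # r) b c (2 # d)) (T + 20) s'"
  proof -
    have "runs grab_loop (stacks r (1 # b) (1 # c) d) T s'" using Leaf by simp
    from runs_Loop_step[OF _ 1 this[unfolded grab_loop_def]] show ?thesis
      unfolding grab_loop_def by (rule runs_mono) simp_all
  qed
  then show ?case by simp
next
  case (Node t1 t2)
  have "runs (push 1 2 ;; push 2 2 ;; push 3 2) (stacks (2 # flatten t1 @ flatten t2 @ r) b c (2 # d))
      (Suc (3 + Suc (3 + 3))) (stacks (2 # flatten t1 @ flatten t2 @ r) (2 # b) (2 # c) (2 # 2 # d))"
    by (rule runs_Seq[OF runs_push_stacks(2) runs_Seq[OF runs_push_stacks(3) runs_push_stacks(4)]])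
  then have "runs (Cond 0 (\<lambda>x. x = 2) (push 1 2 ;; push 2 2 ;; push 3 2) (push 1 1 ;; push 2 1 ;; Drop 3))
     (stacks (2 # flatten t1 @ flatten t2 @ r) b c (2 # d)) (Suc (Suc (3 + Suc (3 + 3))))
     (stacks (2 # flatten t1 @ flatten t2 @ r) (2 # b) (2 # c) (2 # 2 # d))"
    by (intro runs_Cond) simp
  note 1 = runs_Seq[OF this runs_Drop_stacks(1)]
  have "runs grab_loop (stacks (flatten t1 @ flatten t2 @ r) (2 # b) (2 # c) (2 # 2 # d))
      (T + 20 * length (flatten t2) + 20 * length (flatten t1)) s'"
    by (intro Node.IH) (use Node.prems in simp)
  note 2 = runs_Loop_step[OF _ 1 this[unfolded grab_loop_def], folded grab_loop_def]
  have "flatten (Node t1 t2) @ r = 2 # flatten t1 @ flatten t2 @ r" by simp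
  then show ?case by (simp only:) (rule runs_mono[OF 2]; simp)
qed

lemma runs_grab:
  "runs grab (stacks (flatten t @ r) b c d) (25 + 20 * length (flatten t))
     (stacks r (rev (flatten t) @ 3 # b) (rev (flatten t) @ 3 # c) d)"
proof -
  have "runs grab_loop (stacks r (rev (flatten t) @ 3 # b) (rev (flatten t) @ 3 # c) (1 # d)) 1
     (stacks r (rev (flatten t) @ 3 # b) (rev (flatten t) @ 3 # c) (1 # d))"
    unfolding grab_loop_def by (rule runs_Loop_done) simp
  note 1 = runs_Seq[OF runs_grab_loop[OF this] runs_Drop_stacks(2)]
  have "runs (push 1 3 ;; push 2 3 ;; push 3 1 ;; push 3 2 ;; grab_loop ;; Drop 3)
    (stacks (flatten t @ r) b c d)
    (Suc (3 + Suc (3 + Suc (3 + Suc (3 + Suc (1 + 20 * length (flatten t) + 1))))))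
     (stacks r (rev (flatten t) @ 3 # b) (rev (flatten t) @ 3 # c) d)"
    by (intro runs_Seq[OF runs_push_stacks(1)] runs_Seq[OF runs_push_stacks(2)]
      runs_Seq[OF runs_push_stacks(3)] runs_Seq[OF runs_push_stacks(4)] 1)
  then show ?thesis unfolding grab_def by (rule runs_mono) simp
qed

definition discard :: "nat \<Rightarrow> cmd" where
  "discard i = Loop i (\<lambda>x. x \<noteq> 3) (Drop i) ;; Drop i"

text \<open>A command writes a fixed symbol, so copying needs a case distinction between 1 and 2.
  The tree was set aside in reverse, and pushing its symbols one by one restores the order.\<close>

definition give_back :: "nat \<Rightarrow> cmd" where
  "give_back i =
     Loop i (\<lambda>x. x \<noteq> 3) (Cond i (\<lambda>x. x = 2) (push 0 2) (push 0 1) ;; Drop i) ;; Drop i"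

lemma runs_discard:
  assumes "3 \<notin> set l" "s i = l @ 3 # b"
  shows "runs (discard i) s (3 + 2 * length l) (s(i := b))"
proof -
  have "s i = l @ 3 # b \<Longrightarrow>
      runs (Loop i (\<lambda>x. x \<noteq> 3) (Drop i)) s (1 + 2 * length l) (s(i := 3 # b))" for s
    using assms(1)
  proof (induction l arbitrary: s)
    case Nil
    then have "runs (Loop i (\<lambda>x. x \<noteq> 3) (Drop i)) s 1 s" by (intro runs_Loop_done) simp
    moreover have "s(i := 3 # b) = s" using Nil by auto
    ultimately show ?case by simp
  next
    case (Cons x l)
    have "runs (Loop i (\<lambda>x. x \<noteq> 3) (Drop i)) (s(i := l @ 3 # b)) (1 + 2 * length l)
        (s(i := l @ 3 # b, i := 3 # b))"
      by (rule Cons.IH) (use Cons.prems in simp_all)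
    then have "runs (Loop i (\<lambda>x. x \<noteq> 3) (Drop i)) s (Suc (1 + (1 + 2 * length l))) (s(i := 3 # b))"
      using Cons.prems by (intro runs_Loop_step[OF _ runs_Drop[OF refl]]) auto
    then show ?case by (rule runs_mono) simp
  qed
  from runs_mono[OF runs_Seq[OF this[of s, OF assms(2)] runs_Drop[OF refl, of i]],
      of "3 + 2 * length l"]
  show ?thesis unfolding discard_def by simp
qed

lemma runs_give_back:
  assumes "set l \<subseteq> {1, 2}" "s i = l @ 3 # b" "i \<noteq> 0"
  shows "runs (give_back i) s (3 + 10 * length l) (s(0 := rev l @ s 0, i := b))"
proof -
  let ?L = "Loop i (\<lambda>x. x \<noteq> 3) (Cond i (\<lambda>x. x = 2) (push 0 2) (push 0 1) ;; Drop i)"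
  have "s i = l @ 3 # b \<Longrightarrow> runs ?L s (1 + 10 * length l) (s(0 := rev l @ s 0, i := 3 # b))" for s
    using assms(1)
  proof (induction l arbitrary: s)
    case Nil
    then have "runs ?L s 1 s" by (intro runs_Loop_done) simp
    moreover have "s(0 := rev [] @ s 0, i := 3 # b) = s" using Nil by auto
    ultimately show ?case by simp
  next
    case (Cons x l)
    have "runs (Cond i (\<lambda>x. x = 2) (push 0 2) (push 0 1)) s (Suc 3) (s(0 := x # s 0))"
      by (intro runs_Cond) (use Cons.prems in \<open>auto intro!: runs_push\<close>)
    note 1 = runs_Seq[OF this runs_Drop[OF refl, of i]]
    have 2: "(s(0 := x # s 0))(i := tl ((s(0 := x # s 0)) i)) = s(0 := x # s 0, i := l @ 3 # b)"
      using Cons.prems assms(3) by simp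
    let ?s = "s(0 := x # s 0, i := l @ 3 # b)"
    have 3: "?s(0 := rev l @ ?s 0, i := 3 # b) = s(0 := rev (x # l) @ s 0, i := 3 # b)"
      using assms(3) by (auto simp: fun_eq_iff)
    have "runs ?L ?s (1 + 10 * length l) (?s(0 := rev l @ ?s 0, i := 3 # b))"
      by (rule Cons.IH) (use Cons.prems in simp_all)
    then have "runs ?L ?s (1 + 10 * length l) (s(0 := rev (x # l) @ s 0, i := 3 # b))"
      unfolding 3 .
    then have "runs ?L s (Suc (Suc (Suc 3 + 1) + (1 + 10 * length l))) (s(0 := rev (x # l) @ s 0, i := 3 # b))"
      using Cons.prems by (intro runs_Loop_step[OF _ 1[unfolded 2]]) auto
    then show ?case by (rule runs_mono) simp
  qed
  from runs_mono[OF runs_Seq[OF this[of s, OF assms(2)] runs_Drop[OF refl, of i]],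
      of "3 + 10 * length l"]
  show ?thesis unfolding give_back_def by simp
qed

lemma set_flatten: "set (flatten t) \<subseteq> {1, 2}"
  by (induction t) auto

lemma flatten_no_marker: "3 \<notin> set (rev (flatten t))"
  using set_flatten[of t] by auto

definition drop_tree :: cmd where
  "drop_tree = grab ;; discard 1 ;; discard 2"

definition dup_tree :: cmd where
  "dup_tree = grab ;; give_back 1 ;; give_back 2"

definition stash_tree :: cmd where
  "stash_tree = grab ;; discard 2"

text \<open>\<open>grab\<close> leaves a copy of the second tree also on stack 1, on top of the
  first tree. That copy is removed so that the first tree can be returned; the second one follows
  from stack 2 and ends up on top.\<close>

definition swap_trees :: cmd where
  "swap_trees = stash_tree ;; grab ;; discard 1 ;; give_back 1 ;; give_back 2"

lemma ok_tree_cmds [simp]: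
  "ok (discard i) \<longleftrightarrow> i < 4" "ok (give_back i) \<longleftrightarrow> i < 4"
  "ok grab" "ok drop_tree" "ok dup_tree" "ok stash_tree" "ok swap_trees"
  by (auto simp: discard_def give_back_def grab_def grab_loop_def drop_tree_def dup_tree_def
      stash_tree_def swap_trees_def)

lemma runs_discard_tree:
  "runs (discard 1) (stacks a (rev (flatten t) @ 3 # b) c d) (3 + 2 * length (flatten t)) (stacks a b c d)"
  "runs (discard 2) (stacks a b (rev (flatten t) @ 3 # c) d) (3 + 2 * length (flatten t)) (stacks a b c d)"
  using runs_discard[OF flatten_no_marker, of "stacks a (rev (flatten t) @ 3 # b) c d" 1 t b]
    runs_discard[OF flatten_no_marker, of "stacks a b (rev (flatten t) @ 3 # c) d" 2 t c]
  by simp_all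

lemma runs_drop_tree:
  "runs drop_tree (stacks (flatten t @ r) b c d) (40 + 40 * length (flatten t)) (stacks r b c d)"
  unfolding drop_tree_def
  by (rule runs_mono[OF runs_Seq[OF runs_grab
        runs_Seq[OF runs_discard_tree(1) runs_discard_tree(2)]]]) simp

lemma runs_stash_tree:
  "runs stash_tree (stacks (flatten t @ r) b c d) (40 + 40 * length (flatten t))
     (stacks r (rev (flatten t) @ 3 # b) c d)"
  unfolding stash_tree_def by (rule runs_mono[OF runs_Seq[OF runs_grab runs_discard_tree(2)]]) simp

lemma runs_unstash_tree:
  "runs (give_back 1) (stacks r (rev (flatten t) @ 3 # b) c d) (40 + 40 * length (flatten t))
     (stacks (flatten t @ r) b c d)"
  using runs_mono[OF runs_give_back[of "rev (flatten t)" "stacks r (rev (flatten t) @ 3 # b) c d" 1 b],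
      of "40 + 40 * length (flatten t)"] set_flatten[of t] by simp

lemma runs_unstash_tree2:
  "runs (give_back 2) (stacks r b (rev (flatten t) @ 3 # c) d) (40 + 40 * length (flatten t))
     (stacks (flatten t @ r) b c d)"
  using runs_mono[OF runs_give_back[of "rev (flatten t)" "stacks r b (rev (flatten t) @ 3 # c) d" 2 c],
      of "40 + 40 * length (flatten t)"] set_flatten[of t] by simp

lemma runs_dup_tree:
  "runs dup_tree (stacks (flatten t @ r) b c d) (120 + 120 * length (flatten t))
     (stacks (flatten t @ flatten t @ r) b c d)"
  unfolding dup_tree_def
  by (rule runs_mono[OF runs_Seq[OF runs_grab runs_Seq[OF runs_unstash_tree runs_unstash_tree2]]])
    simp

lemma runs_swap_trees:
  "runs swap_trees (stacks (flatten t @ flatten u @ r) b c d)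
     (200 + 200 * length (flatten t) + 200 * length (flatten u))
     (stacks (flatten u @ flatten t @ r) b c d)"
  unfolding swap_trees_def
  by (rule runs_mono[OF runs_Seq[OF runs_stash_tree runs_Seq[OF runs_grab
        runs_Seq[OF runs_discard_tree(1) runs_Seq[OF runs_unstash_tree runs_unstash_tree2]]]]]) simp

section \<open>Polynomial-time functions\<close>

class encodable =
  fixes tree_of :: "'a \<Rightarrow> tree"

instantiation bool :: encodable
begin
definition "tree_of b = (if b then Node Leaf Leaf else Leaf)"
instance ..
end

instantiation prod :: (encodable, encodable) encodable
begin
definition "tree_of p = Node (tree_of (fst p)) (tree_of (snd p))"
instance ..
end

text \<open>A nonempty list has the shape of the pair of its head and tail, so on codes
  \<open>Cons\<close> and pairing are the same operation.\<close>

instantiation list :: (encodable) encodable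
begin
definition "tree_of xs = foldr (\<lambda>x. Node (tree_of x)) xs Leaf"
instance ..
end

text \<open>A number and its list of binary digits share their code, so \<open>bits\<close> costs
  nothing, and the code has length logarithmic in the number.\<close>

instantiation nat :: encodable
begin
definition "tree_of n = tree_of (bits n)"
instance ..
end

definition code :: "'a::encodable \<Rightarrow> nat list" where
  "code x = flatten (tree_of x)"

definition len :: "'a::encodable \<Rightarrow> nat" where
  "len x = length (code x)"

lemma code_simps [simp]:
  "code False = [1]" "code True = [2, 1, 1]"
  "code (x, y) = 2 # code x @ code y"
  "code ([] :: 'a::encodable list) = [1]" "code (z # zs) = 2 # code z @ code zs"
  by (simp_all add: code_def tree_of_bool_def tree_of_prod_def tree_of_list_def)

lemma code_bits [simp]: "code (bits n) = code n"
  by (simp add: code_def tree_of_nat_def)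

lemma len_simps [simp]:
  "len False = 1" "len True = 3" "len (x, y) = Suc (len x + len y)"
  "len ([] :: 'a::encodable list) = 1" "len (z # zs) = Suc (len z + len zs)"
  "len (bits n) = len n"
  by (simp_all add: len_def)

lemma len_bool: "len (b :: bool) \<le> 3"
  by (cases b) simp_all

lemma len_pos: "1 \<le> len x"
proof -
  have "1 \<le> length (flatten t)" for t by (cases t) simp_all
  then show ?thesis by (simp add: len_def code_def)
qed

lemma length_le_len: "length xs \<le> len xs"
  by (induction xs) simp_all

text \<open>Coefficients of type \<open>nat\<close> cannot be negative, so bounds may be enlarged
  inside a polynomial.\<close>

lemma poly_nat_mono: "x \<le> y \<Longrightarrow> poly (p :: nat poly) x \<le> poly p y"
  by (induction p) (simp_all add: add_mono mult_mono)

definition poly_bounded :: "(nat \<Rightarrow> nat) \<Rightarrow> bool" where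
  "poly_bounded T \<longleftrightarrow> (\<exists>p. \<forall>n. T n \<le> poly p n)"

lemma poly_bounded_const: "poly_bounded (\<lambda>n. c)"
  unfolding poly_bounded_def by (rule exI[of _ "[:c:]"]) simp

lemma poly_bounded_id: "poly_bounded (\<lambda>n. n)"
  unfolding poly_bounded_def by (rule exI[of _ "[:0, 1:]"]) simp

lemma poly_bounded_add: "poly_bounded T \<Longrightarrow> poly_bounded U \<Longrightarrow> poly_bounded (\<lambda>n. T n + U n)"
  unfolding poly_bounded_def by (metis poly_add add_mono)

lemma poly_bounded_mult: "poly_bounded T \<Longrightarrow> poly_bounded U \<Longrightarrow> poly_bounded (\<lambda>n. T n * U n)"
  unfolding poly_bounded_def by (metis poly_mult mult_mono zero_le)

lemma poly_bounded_poly: "poly_bounded U \<Longrightarrow> poly_bounded (\<lambda>n. poly p (U n))"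
  unfolding poly_bounded_def by (metis poly_pcompose poly_nat_mono)

lemmas poly_bounded_intros =
  poly_bounded_const poly_bounded_id poly_bounded_add poly_bounded_mult poly_bounded_poly

definition fp :: "('a::encodable \<Rightarrow> 'b::encodable) \<Rightarrow> bool" where
  "fp f \<longleftrightarrow> (\<exists>P p. ok P \<and> (\<forall>x r b c d.
     runs P (stacks (code x @ r) b c d) (poly p (len x)) (stacks (code (f x) @ r) b c d)))"

lemma fpI:
  assumes "ok P" "poly_bounded T"
    and "\<And>x r b c d. runs P (stacks (code x @ r) b c d) (T (len x)) (stacks (code (f x) @ r) b c d)"
  shows "fp f"
proof -
  obtain p where "\<And>n. T n \<le> poly p n" using assms(2) unfolding poly_bounded_def by blast
  then have "runs P (stacks (code x @ r) b c d) (poly p (len x)) (stacks (code (f x) @ r) b c d)"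
    for x r b c d by (rule runs_mono[OF assms(3)])
  with assms(1) show ?thesis unfolding fp_def by blast
qed

text \<open>Only the codes of results matter, and \<open>f\<close> and \<open>g\<close> may have
  different result types. This turns a pair into a nonempty list, or a list of digits into a number,
  without any computation.\<close>

lemma fp_cong: "fp f \<Longrightarrow> (\<And>x. code (f x) = code (g x)) \<Longrightarrow> fp g"
  unfolding fp_def by simp

text \<open>No command pushes more than one symbol. The running time therefore bounds the output,
  and \<open>fp_len\<close> follows: results have polynomial length.\<close>

lemma runs_growth: "runs c s T s' \<Longrightarrow> length (s' 0) \<le> length (s 0) + T"
proof -
  have step: "length (snd (sstep z) 0) \<le> Suc (length (snd z 0))" for z
  proof -
    obtain k s where z: "z = (k, s)" by fastforce
    show ?thesis
    proof (cases k)
      case Nil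
      then show ?thesis by (simp add: z)
    next
      case (Cons c k')
      then show ?thesis by (cases c) (auto simp: z)
    qed
  qed
  have "length (snd ((sstep ^^ t) z) 0) \<le> length (snd z 0) + t" for t z
  proof (induction t)
    case (Suc t)
    then show ?case using step[of "(sstep ^^ t) z"] by simp
  qed simp
  moreover assume "runs c s T s'"
  then obtain t where "t \<le> T" "(sstep ^^ t) ([c], s) = ([], s')" unfolding runs_def by blast
  ultimately show ?thesis by (metis add_left_mono le_trans snd_conv)
qed

lemma fp_len:
  assumes "fp f"
  obtains p where "\<And>x. len (f x) \<le> poly p (len x)"
proof -
  obtain P p where P: "\<And>x r b c d.
      runs P (stacks (code x @ r) b c d) (poly p (len x)) (stacks (code (f x) @ r) b c d)"
    using assms unfolding fp_def by blast
  have "len (f x) \<le> poly ([:0, 1:] + p) (len x)" for x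
    using runs_growth[OF P[of x "[]" "[]" "[]" "[]"]] by (simp add: len_def)
  then show ?thesis by (rule that)
qed

lemmas runs_drop_code = runs_drop_tree[of "tree_of x" for x, folded code_def, folded len_def]
lemmas runs_dup_code = runs_dup_tree[of "tree_of x" for x, folded code_def, folded len_def]
lemmas runs_swap_code =
  runs_swap_trees[of "tree_of x" "tree_of y" for x y, folded code_def, folded len_def]
lemmas runs_stash_code = runs_stash_tree[of "tree_of x" for x, folded code_def, folded len_def]
lemmas runs_unstash_code = runs_unstash_tree[of _ "tree_of x" for x, folded code_def, folded len_def]

section \<open>Closure properties of polynomial-time functions\<close>

lemma fp_comp:
  assumes "fp f" "fp g"
  shows "fp (\<lambda>x. g (f x))"
proof -
  obtain P p where P: "ok P" "\<And>x r b c d.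
      runs P (stacks (code x @ r) b c d) (poly p (len x)) (stacks (code (f x) @ r) b c d)"
    using assms(1) unfolding fp_def by blast
  obtain Q q where Q: "ok Q" "\<And>x r b c d.
      runs Q (stacks (code x @ r) b c d) (poly q (len x)) (stacks (code (g x) @ r) b c d)"
    using assms(2) unfolding fp_def by blast
  obtain l where l: "\<And>x. len (f x) \<le> poly l (len x)" using fp_len[OF assms(1)] by blast
  show ?thesis
  proof (rule fpI)
    show "ok (P ;; Q)" using P Q by simp
    show "poly_bounded (\<lambda>n. 1 + poly p n + poly q (poly l n))" by (intro poly_bounded_intros)
    show "runs (P ;; Q) (stacks (code x @ r) b c d)
       (1 + poly p (len x) + poly q (poly l (len x))) (stacks (code (g (f x)) @ r) b c d)" for x r b c d
      by (rule runs_mono[OF runs_Seq[OF P(2) Q(2)]]) (use poly_nat_mono[OF l, of q x] in simp)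
  qed
qed

text \<open>There is no empty command; pushing a symbol and dropping it again takes its
  place.\<close>

lemma fp_id: "fp (\<lambda>x. x)"
proof (rule fpI)
  show "runs (push 0 1 ;; Drop 0) (stacks (code x @ r) b c d) 5 (stacks (code x @ r) b c d)"
    for x :: 'a and r b c d
    by (rule runs_mono[OF runs_Seq[OF runs_push_stacks(1) runs_Drop_stacks(1)]]) simp
qed (simp_all add: poly_bounded_const)

lemma fp_const: "fp (\<lambda>x. y)"
proof -
  \<comment> \<open>\<open>foldr\<close> lets the first symbol of the code be pushed last, so that
    it ends up on top.\<close>
  define P where "P = foldr (\<lambda>a P. P ;; push 0 a) (code y) drop_tree"
  have ok: "ok (foldr (\<lambda>a P. P ;; push 0 a) l drop_tree)" if "set l \<subseteq> {1, 2}" for l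
    using that by (induction l) auto
  have run: "runs (foldr (\<lambda>a P. P ;; push 0 a) l drop_tree) (stacks (code x @ r) b c d)
      (40 + 40 * len x + 4 * length l) (stacks (l @ r) b c d)" for x :: 'a and l r b c d
  proof (induction l)
    case Nil
    show ?case using runs_drop_code[of x] by simp
  next
    case (Cons a l)
    show ?case
      using runs_mono[OF runs_Seq[OF Cons runs_push_stacks(1)], of "40 + 40 * len x + 4 * length (a # l)"]
      by simp
  qed
  show ?thesis
  proof (rule fpI)
    show "ok P" unfolding P_def code_def by (rule ok[OF set_flatten])
    show "poly_bounded (\<lambda>n. 40 + 40 * n + 4 * len y)" by (intro poly_bounded_intros)
    show "runs P (stacks (code x @ r) b c d) (40 + 40 * len x + 4 * len y) (stacks (code y @ r) b c d)"
      for x :: 'a and r b c d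
      using run unfolding P_def len_def .
  qed
qed

text \<open>\<open>g\<close> is evaluated first, on the upper copy of \<open>x\<close>, and its
  value is then swapped below the other copy: in the code of a pair the first component lies above
  the second.\<close>

lemma fp_Pair:
  assumes "fp f" "fp g"
  shows "fp (\<lambda>x. (f x, g x))"
proof -
  obtain P p where P: "ok P" "\<And>x r b c d.
      runs P (stacks (code x @ r) b c d) (poly p (len x)) (stacks (code (f x) @ r) b c d)"
    using assms(1) unfolding fp_def by blast
  obtain Q q where Q: "ok Q" "\<And>x r b c d.
      runs Q (stacks (code x @ r) b c d) (poly q (len x)) (stacks (code (g x) @ r) b c d)"
    using assms(2) unfolding fp_def by blast
  obtain l where l: "\<And>x. len (g x) \<le> poly l (len x)" using fp_len[OF assms(2)] by blast
  show ?thesis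
  proof (rule fpI)
    show "ok (dup_tree ;; Q ;; swap_trees ;; P ;; push 0 2)" using P Q by simp
    show "poly_bounded (\<lambda>n. 400 + 400 * n + poly q n + 200 * poly l n + poly p n)"
      by (intro poly_bounded_intros)
    show "runs (dup_tree ;; Q ;; swap_trees ;; P ;; push 0 2) (stacks (code x @ r) b c d)
       (400 + 400 * len x + poly q (len x) + 200 * poly l (len x) + poly p (len x))
       (stacks (code (f x, g x) @ r) b c d)" for x r b c d
      using runs_mono[OF runs_Seq[OF runs_dup_code runs_Seq[OF Q(2) runs_Seq[OF runs_swap_code
            runs_Seq[OF P(2) runs_push_stacks(1)]]]],
          of x "400 + 400 * len x + poly q (len x) + 200 * poly l (len x) + poly p (len x)"]
        l[of x] by simp
  qed
qed

lemma fp_fst: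
  assumes "fp f"
  shows "fp (\<lambda>x. fst (f x))"
proof (rule fp_comp[OF assms, of fst], rule fpI)
  show "runs (Drop 0 ;; swap_trees ;; drop_tree) (stacks (code z @ r) b c d)
      (300 + 300 * len z) (stacks (code (fst z) @ r) b c d)" for z and r b c d
  proof (cases z)
    case (Pair x y)
    show ?thesis
      using runs_mono[OF runs_Seq[OF runs_Drop_stacks(1) runs_Seq[OF runs_swap_code runs_drop_code]],
        of x y "300 + 300 * len (x, y)"] Pair by simp
  qed
  show "poly_bounded (\<lambda>n. 300 + 300 * n)" by (intro poly_bounded_intros)
qed simp

lemma fp_snd:
  assumes "fp f"
  shows "fp (\<lambda>x. snd (f x))"
proof (rule fp_comp[OF assms, of snd], rule fpI)
  show "runs (Drop 0 ;; drop_tree) (stacks (code z @ r) b c d)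
      (300 + 300 * len z) (stacks (code (snd z) @ r) b c d)" for z and r b c d
  proof (cases z)
    case (Pair x y)
    show ?thesis
      using runs_mono[OF runs_Seq[OF runs_Drop_stacks(1) runs_drop_code], of x "300 + 300 * len (x, y)"]
        Pair by simp
  qed
  show "poly_bounded (\<lambda>n. 300 + 300 * n)" by (intro poly_bounded_intros)
qed simp

lemma fp_If:
  assumes "fp t" "fp f" "fp g"
  shows "fp (\<lambda>x. if t x then f x else g x)"
proof -
  obtain P p where P: "ok P" "\<And>x r b c d.
      runs P (stacks (code x @ r) b c d) (poly p (len x)) (stacks (code (f x) @ r) b c d)"
    using assms(2) unfolding fp_def by blast
  obtain Q q where Q: "ok Q" "\<And>x r b c d.
      runs Q (stacks (code x @ r) b c d) (poly q (len x)) (stacks (code (g x) @ r) b c d)"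
    using assms(3) unfolding fp_def by blast
  obtain R s where R: "ok R" "\<And>x r b c d.
      runs R (stacks (code x @ r) b c d) (poly s (len x)) (stacks (code (t x) @ r) b c d)"
    using assms(1) unfolding fp_def by blast
  \<comment> \<open>\<open>code True\<close> has three symbols and \<open>code False\<close> has
    one, so the drops remove exactly the truth value and expose the copy of
    \<open>x\<close>.\<close>
  let ?A = "Cond 0 (\<lambda>x. x = 2) (Drop 0 ;; Drop 0 ;; Drop 0 ;; P) (Drop 0 ;; Q)"
  have A: "runs ?A (stacks (code (t x) @ code x @ r) b c d) (20 + poly p (len x) + poly q (len x))
      (stacks (code (if t x then f x else g x) @ r) b c d)" for x r b c d
  proof (cases "t x")
    case True
    note 1 = runs_Seq[OF runs_Drop_stacks(1) runs_Seq[OF runs_Drop_stacks(1)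
          runs_Seq[OF runs_Drop_stacks(1) P(2)]]]
    have "runs (Drop 0 ;; Drop 0 ;; Drop 0 ;; P) (stacks (code (t x) @ code x @ r) b c d)
        (10 + poly p (len x) + poly q (len x)) (stacks (code (if t x then f x else g x) @ r) b c d)"
      using runs_mono[OF 1, of x "10 + poly p (len x) + poly q (len x)"] True by simp
    then have "runs ?A (stacks (code (t x) @ code x @ r) b c d) (Suc (10 + poly p (len x) + poly q (len x)))
        (stacks (code (if t x then f x else g x) @ r) b c d)"
      by (intro runs_Cond) (use True in simp)
    then show ?thesis by (rule runs_mono) simp
  next
    case False
    have "runs (Drop 0 ;; Q) (stacks (code (t x) @ code x @ r) b c d)
        (10 + poly p (len x) + poly q (len x)) (stacks (code (if t x then f x else g x) @ r) b c d)"
      using runs_mono[OF runs_Seq[OF runs_Drop_stacks(1) Q(2)], of x "10 + poly p (len x) + poly q (len x)"]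
        False by simp
    then have "runs ?A (stacks (code (t x) @ code x @ r) b c d) (Suc (10 + poly p (len x) + poly q (len x)))
        (stacks (code (if t x then f x else g x) @ r) b c d)"
      by (intro runs_Cond) (use False in simp)
    then show ?thesis by (rule runs_mono) simp
  qed
  show ?thesis
  proof (rule fpI)
    show "ok (dup_tree ;; R ;; ?A)" using P Q R by simp
    show "poly_bounded (\<lambda>n. 200 + 200 * n + poly s n + (20 + poly p n + poly q n))"
      by (intro poly_bounded_intros)
    show "runs (dup_tree ;; R ;; ?A) (stacks (code x @ r) b c d)
       (200 + 200 * len x + poly s (len x) + (20 + poly p (len x) + poly q (len x)))
       (stacks (code (if t x then f x else g x) @ r) b c d)" for x r b c d
      by (rule runs_mono[OF runs_Seq[OF runs_dup_code runs_Seq[OF R(2) A]]]) simp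
  qed
qed

lemma fp_Cons: "fp f \<Longrightarrow> fp g \<Longrightarrow> fp (\<lambda>x. f x # g x)"
  by (rule fp_cong[OF fp_Pair]) simp_all

text \<open>In the nonempty case the code of \<open>l x\<close> already is that of the pair of head
  and tail. Swapping it below \<open>x\<close> and pushing a 2 yields the triple on which
  \<open>g\<close> works, so nothing has to be taken apart.\<close>

lemma fp_case_list:
  assumes "fp l" "fp f" "fp (\<lambda>p. g (fst p) (fst (snd p)) (snd (snd p)))"
  shows "fp (\<lambda>x. case l x of [] \<Rightarrow> f x | y # ys \<Rightarrow> g x y ys)"
proof -
  let ?h = "\<lambda>x. case l x of [] \<Rightarrow> f x | y # ys \<Rightarrow> g x y ys"
  obtain P p where P: "ok P" "\<And>x r b c d.
      runs P (stacks (code x @ r) b c d) (poly p (len x)) (stacks (code (f x) @ r) b c d)"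
    using assms(2) unfolding fp_def by blast
  obtain Q q where Q: "ok Q" "\<And>x r b c d. runs Q (stacks (code x @ r) b c d) (poly q (len x))
      (stacks (code (g (fst x) (fst (snd x)) (snd (snd x))) @ r) b c d)"
    using assms(3) unfolding fp_def by blast
  obtain R s where R: "ok R" "\<And>x r b c d.
      runs R (stacks (code x @ r) b c d) (poly s (len x)) (stacks (code (l x) @ r) b c d)"
    using assms(1) unfolding fp_def by blast
  obtain m where m: "\<And>x. len (l x) \<le> poly m (len x)" using fp_len[OF assms(1)] by blast
  let ?A = "Cond 0 (\<lambda>x. x = 2) (swap_trees ;; push 0 2 ;; Q) (Drop 0 ;; P)"
  let ?T = "\<lambda>n. 300 + poly p n + (200 * n + 200 * poly m n + poly q (1 + n + poly m n))"
  have A: "runs ?A (stacks (code (l x) @ code x @ r) b c d) (?T (len x))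
      (stacks (code (?h x) @ r) b c d)" for x r b c d
  proof (cases "l x")
    case (Cons y ys)
    have eq: "code (l x) = code (y, ys)" using Cons by simp
    have le: "len (y, ys) \<le> poly m (len x)" using m[of x] Cons by simp
    then have "len (x, (y, ys)) \<le> 1 + len x + poly m (len x)" by simp
    from poly_nat_mono[OF this, of q] le
    have T: "Suc (200 + 200 * len (y, ys) + 200 * len x + Suc (3 + poly q (len (x, (y, ys))))) \<le>
        290 + poly p (len x) + (200 * len x + 200 * poly m (len x) + poly q (1 + len x + poly m (len x)))"
      by (simp del: len_simps)
    have "runs (push 0 2 ;; Q) (stacks (code x @ code (y, ys) @ r) b c d)
        (Suc (3 + poly q (len (x, (y, ys))))) (stacks (code (?h x) @ r) b c d)"
    proof -
      have "runs Q (stacks (2 # code x @ code (y, ys) @ r) b c d) (poly q (len (x, (y, ys))))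
          (stacks (code (?h x) @ r) b c d)"
        using Q(2)[of "(x, (y, ys))" r b c d] Cons by simp
      then show ?thesis by (rule runs_Seq[OF runs_push_stacks(1)])
    qed
    from runs_mono[OF runs_Seq[OF runs_swap_code this] T]
    have "runs (swap_trees ;; push 0 2 ;; Q) (stacks (code (l x) @ code x @ r) b c d)
        (290 + poly p (len x) + (200 * len x + 200 * poly m (len x) + poly q (1 + len x + poly m (len x))))
        (stacks (code (?h x) @ r) b c d)"
      unfolding eq .
    then have "runs ?A (stacks (code (l x) @ code x @ r) b c d)
        (Suc (290 + poly p (len x) + (200 * len x + 200 * poly m (len x) + poly q (1 + len x + poly m (len x)))))
        (stacks (code (?h x) @ r) b c d)"
      by (intro runs_Cond) (use Cons in simp)
    then show ?thesis by (rule runs_mono) simp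
  next
    case Nil
    have "runs (Drop 0 ;; P) (stacks (code (l x) @ code x @ r) b c d)
        (10 + poly p (len x)) (stacks (code (?h x) @ r) b c d)"
      using runs_mono[OF runs_Seq[OF runs_Drop_stacks(1) P(2)], of x "10 + poly p (len x)"]
        Nil by simp
    then have "runs ?A (stacks (code (l x) @ code x @ r) b c d) (Suc (10 + poly p (len x)))
        (stacks (code (?h x) @ r) b c d)"
      by (intro runs_Cond) (use Nil in simp)
    then show ?thesis by (rule runs_mono) simp
  qed
  show ?thesis
  proof (rule fpI)
    show "ok (dup_tree ;; R ;; ?A)" using P Q R by simp
    show "poly_bounded (\<lambda>n. 200 + 200 * n + poly s n + ?T n)" by (intro poly_bounded_intros)
    show "runs (dup_tree ;; R ;; ?A) (stacks (code x @ r) b c d)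
       (200 + 200 * len x + poly s (len x) + ?T (len x)) (stacks (code (?h x) @ r) b c d)" for x r b c d
      by (rule runs_mono[OF runs_Seq[OF runs_dup_code runs_Seq[OF R(2) A]]]) simp
  qed
qed

text \<open>Applied to the prefixes of the list, \<open>bound\<close> limits every intermediate
  accumulator and hence the cost of every round. While one element is processed, the rest of the
  list waits on stack 1.\<close>

lemma fp_fold_pair:
  fixes G :: "'x::encodable \<Rightarrow> 's::encodable \<Rightarrow> 's"
  assumes "fp (\<lambda>p. G (fst p) (snd p))"
    and bound: "\<And>xs s. len (fold G xs s) \<le> poly q (len xs + len s)"
  shows "fp (\<lambda>p. fold G (fst p) (snd p))"
proof -
  obtain P p where P: "ok P" "\<And>x r b c d.
      runs P (stacks (code x @ r) b c d) (poly p (len x)) (stacks (code (G (fst x) (snd x)) @ r) b c d)"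
    using assms(1) unfolding fp_def by blast
  let ?B = "Drop 0 ;; swap_trees ;; stash_tree ;; push 0 2 ;; P ;; give_back 1"
  let ?L = "Loop 0 (\<lambda>x. x = 2) ?B"
  \<comment> \<open>\<open>N\<close> bounds the remaining list and \<open>B\<close> all accumulators
    still to come. Both stay fixed during the induction, so that every round has the same
    cost.\<close>
  have loop: "runs ?L (stacks (code xs @ code s @ r) b c d)
      (1 + length xs * (400 + 400 * N + poly p (1 + N + B))) (stacks (1 # code (fold G xs s) @ r) b c d)"
    if "len xs \<le> N" "\<And>ys zs. xs = ys @ zs \<Longrightarrow> len (fold G ys s) \<le> B" for xs s N B r b c d
    using that
  proof (induction xs arbitrary: s)
    case Nil
    then show ?case using runs_Loop_done[of "\<lambda>x. x = 2" "stacks (code ([] :: 'x list) @ code s @ r) b c d" 0 ?B] by simp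
  next
    case (Cons x xs)
    have "len s \<le> B" using Cons.prems(2)[of "[]"] by simp
    then have "len (x, s) \<le> 1 + N + B" using Cons.prems(1) by simp
    from poly_nat_mono[OF this, of p]
    have T: "Suc (1 + Suc ((200 + 200 * len x + 200 * len xs) + Suc ((40 + 40 * len xs) +
        Suc (3 + Suc (poly p (len (x, s)) + (40 + 40 * len xs)))))) \<le> 399 + 400 * N + poly p (1 + N + B)"
      using Cons.prems(1) by (simp del: len_simps(3))
    have "runs (push 0 2 ;; P ;; give_back 1) (stacks (code x @ code s @ r) (rev (code xs) @ 3 # b) c d)
        (Suc (3 + Suc (poly p (len (x, s)) + (40 + 40 * len xs)))) (stacks (code xs @ code (G x s) @ r) b c d)"
    proof -
      have "runs P (stacks (2 # code x @ code s @ r) (rev (code xs) @ 3 # b) c d) (poly p (len (x, s)))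
          (stacks (code (G x s) @ r) (rev (code xs) @ 3 # b) c d)"
        using P(2)[of "(x, s)" r "rev (code xs) @ 3 # b" c d] by simp
      then show ?thesis by (rule runs_Seq[OF runs_push_stacks(1) runs_Seq[OF _ runs_unstash_code]])
    qed
    from runs_mono[OF runs_Seq[OF runs_Drop_stacks(1) runs_Seq[OF runs_swap_code runs_Seq[OF
            runs_stash_code this]]] T]
    have 1: "runs ?B (stacks (code (x # xs) @ code s @ r) b c d) (399 + 400 * N + poly p (1 + N + B))
        (stacks (code xs @ code (G x s) @ r) b c d)" by simp
    have 2: "runs ?L (stacks (code xs @ code (G x s) @ r) b c d)
        (1 + length xs * (400 + 400 * N + poly p (1 + N + B)))
        (stacks (1 # code (fold G (x # xs) s) @ r) b c d)"
      using Cons.IH[of "G x s"] Cons.prems(1) Cons.prems(2)[of "x # ys" for ys] by simp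
    show ?case by (rule runs_mono[OF runs_Loop_step[OF _ 1 2]]) simp_all
  qed
  show ?thesis
  proof (rule fpI)
    let ?T = "\<lambda>n. 10 + n * (400 + 400 * n + poly p (1 + n + poly q n))"
    show "ok (Drop 0 ;; ?L ;; Drop 0)" using P by simp
    show "poly_bounded ?T" by (intro poly_bounded_intros)
    show "runs (Drop 0 ;; ?L ;; Drop 0) (stacks (code z @ r) b c d) (?T (len z))
        (stacks (code (fold G (fst z) (snd z)) @ r) b c d)" for z r b c d
    proof -
      obtain xs s where z: "z = (xs, s)" by fastforce
      have "len (fold G ys s) \<le> poly q (len z)" if "xs = ys @ zs" for ys zs
      proof -
        have "len ys \<le> len (ys @ zs)" using len_pos[of zs] by (induction ys) simp_all
        then have "len ys + len s \<le> len z" using that z by simp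
        from poly_nat_mono[OF this] bound[of ys s] show ?thesis by (rule le_trans[rotated])
      qed
      note 1 = loop[OF _ this, of xs "len z"]
      have "length xs \<le> len z" using length_le_len[of xs] z by simp
      from mult_le_mono1[OF this, of "400 + 400 * len z + poly p (1 + len z + poly q (len z))"]
      have T: "Suc (1 + Suc (1 + length xs * (400 + 400 * len z + poly p (1 + len z + poly q (len z))) + 1))
          \<le> ?T (len z)" by linarith
      have "len xs \<le> len z" using z by simp
      from runs_mono[OF runs_Seq[OF runs_Drop_stacks(1) runs_Seq[OF 1[OF this] runs_Drop_stacks(1)]] T]
      show ?thesis using z by simp
    qed
  qed
qed

text \<open>The increment does not depend on \<open>s\<close>, so the increments of a whole fold add
  up to a polynomial. The step also reads \<open>e\<close>, which therefore travels along as the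
  first component of the accumulator.\<close>

lemma fp_fold:
  fixes g :: "'e::encodable \<Rightarrow> 'x::encodable \<Rightarrow> 's::encodable \<Rightarrow> 's"
  assumes "fp X" "fp A" "fp (\<lambda>p. g (fst p) (fst (snd p)) (snd (snd p)))"
    and growth: "\<And>e x s. len (g e x s) \<le> len s + poly q (len e + len x)"
  shows "fp (\<lambda>e. fold (g e) (X e) (A e))"
proof -
  define G where "G x es = (fst es, g (fst es) x (snd es))" for x es
  have eq: "fold G xs (e, s) = (e, fold (g e) xs s)" for xs e s
    by (induction xs arbitrary: s) (simp_all add: G_def)
  have len: "len (fold (g e) xs s) \<le> len s + length xs * poly q (len e + len xs)" for e xs s
  proof (induction xs arbitrary: s)
    case (Cons x xs)
    let ?q = "poly q (len e + len (x # xs))"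
    have "poly q (len e + len x) \<le> ?q" by (rule poly_nat_mono) simp
    moreover have "length xs * poly q (len e + len xs) \<le> length xs * ?q"
      by (intro mult_le_mono poly_nat_mono) simp_all
    ultimately have "len (fold (g e) xs (g e x s)) \<le> len s + (?q + length xs * ?q)"
      using Cons[of "g e x s"] growth[of e x s] by linarith
    then show ?case by (simp only: fold_simps list.size mult_Suc add_0 add_Suc_right add_0_right)
  qed simp
  have "fp (\<lambda>p. fold G (fst p) (snd p))"
  proof (rule fp_fold_pair)
    have 1: "fp (\<lambda>p. (fst (snd p), (fst p, snd (snd p))))"
      by (rule fp_Pair[OF fp_fst[OF fp_snd[OF fp_id]]
            fp_Pair[OF fp_fst[OF fp_id] fp_snd[OF fp_snd[OF fp_id]]]])
    show "fp (\<lambda>p. G (fst p) (snd p))"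
      using fp_Pair[OF fp_fst[OF fp_snd[OF fp_id]] fp_comp[OF 1 assms(3)]] by (simp add: G_def)
    show "len (fold G xs es) \<le> poly ([:1, 1:] + [:0, 1:] * q) (len xs + len es)" for xs es
    proof -
      obtain e s where es: "es = (e, s)" by fastforce
      have "length xs * poly q (len e + len xs) \<le> (len xs + len es) * poly q (len xs + len es)"
        using length_le_len[of xs] es by (intro mult_le_mono poly_nat_mono) simp_all
      with len[of e xs s] show ?thesis by (simp add: es eq)
    qed
  qed
  from fp_comp[OF fp_Pair[OF assms(1) fp_Pair[OF fp_id assms(2)]] this]
  have "fp (\<lambda>e. fold G (X e) (e, A e))" by simp
  from fp_snd[OF this] show ?thesis by (simp add: eq)
qed

section \<open>Lists and binary arithmetic in polynomial time\<close>

lemma fp_comp2: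
  assumes "fp (\<lambda>p. f (fst p) (snd p))" "fp a" "fp b"
  shows "fp (\<lambda>x. f (a x) (b x))"
  using fp_comp[OF fp_Pair[OF assms(2,3)] assms(1)] by simp

lemma fp_conj: "fp a \<Longrightarrow> fp b \<Longrightarrow> fp (\<lambda>x. a x \<and> b x)"
  by (rule fp_cong[OF fp_If[of a b "\<lambda>x. False"]]) (auto intro: fp_const)

lemma fp_disj: "fp a \<Longrightarrow> fp b \<Longrightarrow> fp (\<lambda>x. a x \<or> b x)"
  by (rule fp_cong[OF fp_If[of a "\<lambda>x. True" b]]) (auto intro: fp_const)

lemma fp_not: "fp a \<Longrightarrow> fp (\<lambda>x. \<not> a x)"
  by (rule fp_cong[OF fp_If[of a "\<lambda>x. False" "\<lambda>x. True"]]) (auto intro: fp_const)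

lemma fp_bool_eq: "fp a \<Longrightarrow> fp b \<Longrightarrow> fp (\<lambda>x. a x = (b x :: bool))"
  by (rule fp_cong[OF fp_If[of a b "\<lambda>x. \<not> b x"]]) (auto intro: fp_not)

lemmas fp_intros = fp_id fp_const fp_Pair fp_fst fp_snd fp_If fp_Cons fp_case_list
  fp_conj fp_disj fp_not

lemma fp_rev:
  assumes "fp X"
  shows "fp (\<lambda>e. rev (X e))"
proof -
  have "fp (\<lambda>e. fold (\<lambda>x s. x # s) (X e) [])"
  proof (rule fp_fold[where g = "\<lambda>e x s. x # s" and q = "[:1, 1:]"])
    show "fp (\<lambda>p. fst (snd p) # snd (snd p))" by (intro fp_intros)
  qed (simp_all add: assms fp_const)
  then show ?thesis by (simp add: rev_conv_fold)
qed

lemma fp_append: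
  assumes "fp X" "fp Y"
  shows "fp (\<lambda>e. X e @ Y e)"
proof -
  have "fp (\<lambda>e. fold (\<lambda>x s. x # s) (rev (X e)) (Y e))"
  proof (rule fp_fold[where g = "\<lambda>e x s. x # s" and q = "[:1, 1:]"])
    show "fp (\<lambda>p. fst (snd p) # snd (snd p))" by (intro fp_intros)
  qed (simp_all add: assms fp_rev)
  moreover have "fold (\<lambda>x s. x # s) (rev xs) ys = xs @ ys" for xs ys :: "'b list"
    by (induction xs arbitrary: ys rule: rev_induct) simp_all
  ultimately show ?thesis by simp
qed

lemma fp_map:
  assumes "fp (\<lambda>p. f (fst p) (snd p))" "fp X"
  shows "fp (\<lambda>e. map (f e) (X e))"
proof -
  obtain q where q: "\<And>p. len (f (fst p) (snd p)) \<le> poly q (len p)"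
    using fp_len[OF assms(1)] by blast
  have "fp (\<lambda>e. fold (\<lambda>x s. f e x # s) (X e) [])"
  \<comment> \<open>\<open>pcompose q [:1, 1:]\<close> accounts for
    \<open>len (e, x) = 1 + len e + len x\<close>; the other 1 is the new list cell.\<close>
  proof (rule fp_fold[where g = "\<lambda>e x s. f e x # s" and q = "1 + pcompose q [:1, 1:]"])
    show "fp (\<lambda>p. f (fst p) (fst (snd p)) # snd (snd p))"
      by (intro fp_Cons fp_comp2[OF assms(1)] fp_fst fp_snd fp_id)
    show "len (f e x # s) \<le> len s + poly (1 + pcompose q [:1, 1:]) (len e + len x)" for e x s
      using q[of "(e, x)"] by (simp add: poly_pcompose)
  qed (simp_all add: assms fp_const)
  moreover have "fold (\<lambda>x s. f e x # s) xs ys = rev (map (f e) xs) @ ys" for e xs ys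
    by (induction xs arbitrary: ys) simp_all
  ultimately show ?thesis using fp_rev[of "\<lambda>e. rev (map (f e) (X e))"] by simp
qed

lemma fp_filter:
  assumes "fp (\<lambda>p. P (fst p) (snd p))" "fp X"
  shows "fp (\<lambda>e. filter (P e) (X e))"
proof -
  have "fp (\<lambda>e. fold (\<lambda>x s. if P e x then x # s else s) (X e) [])"
  proof (rule fp_fold[where g = "\<lambda>e x s. if P e x then x # s else s" and q = "[:1, 1:]"])
    show "fp (\<lambda>p. if P (fst p) (fst (snd p)) then fst (snd p) # snd (snd p) else snd (snd p))"
      by (intro fp_If fp_Cons fp_comp2[OF assms(1)] fp_fst fp_snd fp_id)
  qed (simp_all add: assms fp_const)
  moreover have "fold (\<lambda>x s. if P e x then x # s else s) xs ys = rev (filter (P e) xs) @ ys" for e xs ys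
    by (induction xs arbitrary: ys) simp_all
  ultimately show ?thesis using fp_rev[of "\<lambda>e. rev (filter (P e) (X e))"] by simp
qed

lemma fp_list_ex:
  assumes "fp (\<lambda>p. P (fst p) (snd p))" "fp X"
  shows "fp (\<lambda>e. list_ex (P e) (X e))"
proof -
  have "fp (\<lambda>e. fold (\<lambda>x s. P e x \<or> s) (X e) False)"
  proof (rule fp_fold[where g = "\<lambda>e x s. P e x \<or> s" and q = "[:3:]"])
    show "fp (\<lambda>p. P (fst p) (fst (snd p)) \<or> snd (snd p))"
      by (intro fp_disj fp_comp2[OF assms(1)] fp_fst fp_snd fp_id)
    show "len (P e x \<or> s) \<le> len s + poly [:3:] (len e + len x)" for e x s
      using len_bool[of "P e x \<or> s"] by simp
  qed (simp_all add: assms fp_const)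
  moreover have "fold (\<lambda>x s. P e x \<or> s) xs b \<longleftrightarrow> list_ex (P e) xs \<or> b" for e xs b
    by (induction xs arbitrary: b) auto
  ultimately show ?thesis by simp
qed

lemma fp_list_all:
  assumes "fp (\<lambda>p. P (fst p) (snd p))" "fp X"
  shows "fp (\<lambda>e. list_all (P e) (X e))"
proof -
  have "fp (\<lambda>e. \<not> list_ex (\<lambda>x. \<not> P e x) (X e))"
    by (intro fp_not fp_list_ex assms)
  moreover have "\<not> list_ex (\<lambda>x. \<not> P e x) xs \<longleftrightarrow> list_all (P e) xs" for e xs
    by (induction xs) auto
  ultimately show ?thesis by simp
qed

section \<open>Binary numbers\<close>

lemma fp_bits: "fp a \<Longrightarrow> fp (\<lambda>x. bits (a x))"
  by (rule fp_cong) simp_all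

lemma bits_0: "bits 0 = []"
  by (subst bits.simps) simp

lemma bits_pos: "n \<noteq> 0 \<Longrightarrow> bits n = odd n # bits (n div 2)"
  by (subst bits.simps) simp

lemma fp_odd:
  assumes "fp a"
  shows "fp (\<lambda>x. odd (a x :: nat))"
proof -
  have "fp (\<lambda>x. case bits (a x) of [] \<Rightarrow> False | b # bs \<Rightarrow> b)"
    by (intro fp_intros fp_bits assms)
  moreover have "(case bits n of [] \<Rightarrow> False | b # bs \<Rightarrow> b) = odd n" for n
    by (cases "n = 0") (simp_all add: bits_0 bits_pos)
  ultimately show ?thesis by simp
qed

lemma fp_is_0:
  assumes "fp a"
  shows "fp (\<lambda>x. a x = (0 :: nat))"
proof -
  have "fp (\<lambda>x. case bits (a x) of [] \<Rightarrow> True | b # bs \<Rightarrow> False)"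
    by (intro fp_intros fp_bits assms)
  moreover have "(case bits n of [] \<Rightarrow> True | b # bs \<Rightarrow> False) = (n = 0)" for n
    by (cases "n = 0") (simp_all add: bits_0 bits_pos)
  ultimately show ?thesis by simp
qed

lemma fp_div2:
  assumes "fp a"
  shows "fp (\<lambda>x. a x div (2 :: nat))"
proof -
  have "fp (\<lambda>x. case bits (a x) of [] \<Rightarrow> [] | b # bs \<Rightarrow> bs)"
    by (intro fp_intros fp_bits assms)
  moreover have "(case bits n of [] \<Rightarrow> [] | b # bs \<Rightarrow> bs) = bits (n div 2)" for n
    by (cases "n = 0") (simp_all add: bits_0 bits_pos)
  ultimately have "fp (\<lambda>x. bits (a x div 2))" by simp
  then show ?thesis by (rule fp_cong) simp
qed

lemma less_bits: "n < 2 ^ length (bits n)"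
proof (induction n rule: less_induct)
  case (less n)
  show ?case
  proof (cases "n = 0")
    case False
    then show ?thesis using less[of "n div 2"] by (simp add: bits_pos)
  qed (simp add: bits_0)
qed

text \<open>A digit costs one symbol for its list cell and then 1 for \<open>False\<close> or 3 for
  \<open>True\<close>, that is, 2 or 4 in all.\<close>

lemma len_bits_pos: "(n :: nat) \<noteq> 0 \<Longrightarrow> len n = 2 + 2 * of_bool (odd n) + len (n div 2)"
  using len_simps(6)[of n] len_simps(6)[of "n div 2"] by (cases "odd n") (simp_all add: bits_pos)

lemma len_0: "len (0 :: nat) = 1"
  using len_simps(6)[of 0] by (simp add: bits_0 del: len_simps(6))

lemma len_div2: "len (n div 2) \<le> len (n :: nat)"
  by (cases "n = 0") (simp_all add: len_bits_pos)

text \<open>A full adder: the conditional is the majority of the two low bits and the incoming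
  carry.\<close>

lemma half_add_carry:
  "(a + b + of_bool c) div (2 :: nat) = a div 2 + b div 2 + of_bool (if odd a = odd b then odd a else c)"
  by (cases c; cases "odd a"; cases "odd b"; simp; presburger)

text \<open>Nested equality of three truth values is their exclusive or, the sum digit of the full
  adder.\<close>

lemma odd_add_carry: "odd (a + b + of_bool c :: nat) = (odd a = (odd b = c))"
  by (cases c) auto

text \<open>
  Folding with addition needs this bound with coefficient 1 in both summands, hence the
  induction: a bound through the number of binary digits would lose a factor.
\<close>

lemma len_add_carry: "len (a + b + of_bool c :: nat) \<le> len a + len b + 4 * of_bool c"
proof (induction "a + b" arbitrary: a b c rule: less_induct)
  case less
  show ?case
  proof (cases "a = 0 \<and> b = 0")
    case True
    then show ?thesis by (cases c) (simp_all add: len_bits_pos[of "Suc 0"] len_0)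
  next
    case False
    define n where "n = a + b + of_bool c"
    define c' where "c' \<longleftrightarrow> (if odd a = odd b then odd a else c)"
    have "a div 2 + b div 2 < a + b" using False by linarith
    from less[OF this, of c'] have "len (n div 2) \<le> len (a div 2) + len (b div 2) + 4 * of_bool c'"
      unfolding n_def half_add_carry c'_def .
    moreover have "len n = 2 + 2 * of_bool (odd n) + len (n div 2)"
      by (rule len_bits_pos) (use False in \<open>auto simp: n_def\<close>)
    \<comment> \<open>Twice the full adder identity, by which the low bits and the carry sum to the
      digit plus twice the outgoing carry. It balances the weight 4 of that carry against the extra
      2 that a digit 1 costs.\<close>
    moreover have "4 * of_bool c' + 2 * of_bool (odd n) = 2 * of_bool (odd a) + 2 * of_bool (odd b) + 2 * (of_bool c :: nat)"
      unfolding n_def odd_add_carry c'_def by (cases "odd a"; cases "odd b"; cases c) simp_all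
    moreover have "2 + (2 * of_bool (odd a) + len (a div 2)) + (2 * of_bool (odd b) + len (b div 2)) \<le> len a + len b"
      using False len_bits_pos[of a] len_bits_pos[of b] by (cases "a = 0"; cases "b = 0") (simp_all add: len_0)
    moreover have "2 * of_bool c \<le> (4 * of_bool c :: nat)" by simp
    ultimately show ?thesis unfolding n_def by linarith
  qed
qed

text \<open>One round of serial addition, with the output digits collected most recent first. Once
  both numbers and the carry are used up the state no longer changes, so surplus rounds write no
  leading zeros.\<close>

definition add_step :: "nat \<times> nat \<times> bool \<times> bool list \<Rightarrow> nat \<times> nat \<times> bool \<times> bool list" where
  "add_step s =
     (let a = fst s; b = fst (snd s); c = fst (snd (snd s))
      in if a = 0 \<and> b = 0 \<and> \<not> c then s
         else (a div 2, b div 2, if odd a = odd b then odd a else c,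
               (odd a = (odd b = c)) # snd (snd (snd s))))"

fun add_value :: "nat \<times> nat \<times> bool \<times> bool list \<Rightarrow> nat" where
  "add_value (a, b, c, out) = a + b + of_bool c"

lemma add_step_value: "add_value (add_step s) = add_value s div 2"
  by (cases s) (auto simp: add_step_def Let_def half_add_carry simp del: of_bool_eq_iff)

text \<open>The invariant of serial addition: the digits already written, followed by those of what
  remains, are the digits of the sum. A round moves at most one digit across.\<close>

lemma add_step_out:
  "rev (snd (snd (snd (add_step s)))) @ bits (add_value (add_step s)) =
   rev (snd (snd (snd s))) @ bits (add_value s)"
proof -
  obtain a b c out where s: "s = (a, b, c, out)" by (cases s)
  show ?thesis
  proof (cases "a = 0 \<and> b = 0 \<and> \<not> c")
    case True
    then show ?thesis by (simp add: s add_step_def)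
  next
    case False
    then have "bits (add_value s) = odd (add_value s) # bits (add_value s div 2)"
      by (intro bits_pos) (auto simp: s)
    moreover have "odd (add_value s) \<longleftrightarrow> (odd a = (odd b = c))"
      by (simp only: s add_value.simps odd_add_carry)
    moreover have "snd (snd (snd (add_step s))) = (odd a = (odd b = c)) # out"
      using False by (auto simp: s add_step_def Let_def)
    ultimately show ?thesis by (simp add: add_step_value) (simp add: s)
  qed
qed

lemma fp_add:
  assumes "fp a" "fp b"
  shows "fp (\<lambda>x. a x + b x :: nat)"
proof -
  define run where "run xs a b = fold (\<lambda>_ :: bool. add_step) xs (a, b, False, [])" for xs a b
  have val: "add_value (fold (\<lambda>_. add_step) xs s) = add_value s div 2 ^ length xs" for xs :: "bool list" and s
    by (induction xs arbitrary: s) (simp_all add: add_step_value div_mult2_eq)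
  have out: "rev (snd (snd (snd (fold (\<lambda>_. add_step) xs s)))) @ bits (add_value (fold (\<lambda>_. add_step) xs s)) =
      rev (snd (snd (snd s))) @ bits (add_value s)" for xs :: "bool list" and s
    by (induction xs arbitrary: s) (simp_all add: add_step_out)
  \<comment> \<open>The list is only a clock; its elements are ignored. The sum is below 2 to the
    power of its length, with the extra \<open>True\<close> making room for the last carry, so
    nothing remains to be added at the end.\<close>
  have result: "rev (snd (snd (snd (run (True # bits a @ bits b) a b)))) = bits (a + b)" for a b
  proof -
    have "a + b < 2 ^ length (bits a) + 2 ^ length (bits b)" using less_bits[of a] less_bits[of b] by simp
    also have "\<dots> \<le> 2 ^ (length (bits a) + length (bits b)) + 2 ^ (length (bits a) + length (bits b))"
      by (intro add_mono power_increasing) simp_all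
    finally have "a + b < 2 ^ length (True # bits a @ bits b)" by simp
    then have "add_value (run (True # bits a @ bits b) a b) = 0" unfolding run_def val by simp
    then show ?thesis
      using out[of "True # bits a @ bits b" "(a, b, False, [])"] unfolding run_def by (simp add: bits_0)
  qed
  have step: "fp (\<lambda>p :: ('a \<times> bool \<times> nat \<times> nat \<times> bool \<times> bool list). add_step (snd (snd p)))"
    unfolding add_step_def Let_def by (intro fp_intros fp_is_0 fp_div2 fp_odd fp_bool_eq)
  have "fp (\<lambda>x. fold (\<lambda>_. add_step) (True # bits (a x) @ bits (b x)) (a x, b x, False, []))"
  proof (rule fp_fold[where g = "\<lambda>_ _. add_step" and q = "[:10:]", OF _ _ step])
    show "fp (\<lambda>x. True # bits (a x) @ bits (b x))" "fp (\<lambda>x. (a x, b x, False, [] :: bool list))"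
      by (intro fp_intros fp_append fp_bits assms)+
    show "len (add_step s) \<le> len s + poly [:10:] (len e + len x)" for e :: 'a and x :: bool and s
    proof -
      obtain a b c out where s: "s = (a, b, c, out)" by (cases s)
      show ?thesis
        using len_div2[of a] len_div2[of b] len_bool[of "if odd a = odd b then odd a else c"]
          len_bool[of "odd a = (odd b = c)"]
        by (simp add: s add_step_def)
    qed
  qed
  then have "fp (\<lambda>x. rev (snd (snd (snd (run (True # bits (a x) @ bits (b x)) (a x) (b x))))))"
    unfolding run_def by (intro fp_rev fp_snd)
  then show ?thesis by (rule fp_cong) (simp add: result)
qed

text \<open>Digits arrive from the least significant end, so a later difference overrides the
  verdict on the earlier ones, kept in the third component.\<close>

definition less_step :: "nat \<times> nat \<times> bool \<Rightarrow> nat \<times> nat \<times> bool" where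
  "less_step s =
     (fst s div 2, fst (snd s) div 2,
      if odd (fst s) = odd (fst (snd s)) then snd (snd s) else odd (fst (snd s)))"

fun less_value :: "nat \<times> nat \<times> bool \<Rightarrow> bool" where
  "less_value (a, b, c) \<longleftrightarrow> a < b \<or> a = b \<and> c"

text \<open>The halves decide unless they are equal; then the low bits decide, and on another tie
  \<open>c\<close> does. Once both numbers have become 0, the preserved value is just
  \<open>c\<close>.\<close>

lemma less_step_value: "less_value (less_step s) = less_value s"
proof -
  obtain a b c where s: "s = (a, b, c)" by (cases s)
  show ?thesis
    by (cases "odd a"; cases "odd b"; auto simp: s less_step_def elim!: oddE evenE; presburger)
qed

lemma fp_less:
  assumes "fp a" "fp b"
  shows "fp (\<lambda>x. a x < (b x :: nat))"
proof -
  define run where "run xs a b = fold (\<lambda>_ :: bool. less_step) xs (a, b, False)" for xs a b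
  have val: "less_value (fold (\<lambda>_. less_step) xs s) = less_value s" for xs :: "bool list" and s
    by (induction xs arbitrary: s) (simp_all add: less_step_value)
  have zero: "fst (fold (\<lambda>_. less_step) xs s) = fst s div 2 ^ length xs \<and>
      fst (snd (fold (\<lambda>_. less_step) xs s)) = fst (snd s) div 2 ^ length xs" for xs :: "bool list" and s
    by (induction xs arbitrary: s) (simp_all add: less_step_def div_mult2_eq)
  have result: "snd (snd (run (bits a @ bits b) a b)) \<longleftrightarrow> a < b" for a b
  proof -
    have "a < 2 ^ length (bits a @ bits b)" "b < 2 ^ length (bits a @ bits b)"
      using less_bits[of a] less_bits[of b] by (auto elim!: less_le_trans intro!: power_increasing)
    then have "fst (run (bits a @ bits b) a b) = 0 \<and> fst (snd (run (bits a @ bits b) a b)) = 0"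
      unfolding run_def using zero[of "bits a @ bits b" "(a, b, False)"] by simp
    then show ?thesis
      using val[of "bits a @ bits b" "(a, b, False)"] unfolding run_def
      by (cases "fold (\<lambda>_. less_step) (bits a @ bits b) (a, b, False)") simp
  qed
  have step: "fp (\<lambda>p :: ('a \<times> bool \<times> nat \<times> nat \<times> bool). less_step (snd (snd p)))"
    unfolding less_step_def by (intro fp_intros fp_div2 fp_odd fp_bool_eq)
  have "fp (\<lambda>x. fold (\<lambda>_. less_step) (bits (a x) @ bits (b x)) (a x, b x, False))"
  proof (rule fp_fold[where g = "\<lambda>_ _. less_step" and q = "[:10:]", OF _ _ step])
    show "fp (\<lambda>x. bits (a x) @ bits (b x))" "fp (\<lambda>x. (a x, b x, False))"
      by (intro fp_intros fp_append fp_bits assms)+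
    show "len (less_step s) \<le> len s + poly [:10:] (len e + len x)" for e :: 'a and x :: bool and s
    proof -
      obtain a b c where s: "s = (a, b, c)" by (cases s)
      show ?thesis
        using len_div2[of a] len_div2[of b] len_bool[of "odd b"]
        by (simp add: s less_step_def)
    qed
  qed
  then have "fp (\<lambda>x. snd (snd (run (bits (a x) @ bits (b x)) (a x) (b x))))"
    unfolding run_def by (intro fp_snd)
  then show ?thesis by (simp add: result)
qed

lemma fp_eq:
  assumes "fp a" "fp b"
  shows "fp (\<lambda>x. a x = (b x :: nat))"
proof -
  have "fp (\<lambda>x. \<not> a x < b x \<and> \<not> b x < a x)" by (intro fp_conj fp_not fp_less assms)
  moreover have "\<not> m < n \<and> \<not> n < m \<longleftrightarrow> m = n" for m n :: nat by auto
  ultimately show ?thesis by simp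
qed

text \<open>By \<open>len_add_carry\<close> the partial sum grows by at most the length of the new
  summand, which is the additive growth that \<open>fp_fold\<close> asks for.\<close>

lemma fp_sum:
  assumes "fp (\<lambda>p. f (fst p) (snd p))" "fp X"
  shows "fp (\<lambda>e. \<Sum>x\<leftarrow>X e. f e x :: nat)"
proof -
  obtain q where q: "\<And>p. len (f (fst p) (snd p)) \<le> poly q (len p)"
    using fp_len[OF assms(1)] by blast
  have "fp (\<lambda>e. fold (\<lambda>x s. f e x + s) (X e) 0)"
  proof (rule fp_fold[where g = "\<lambda>e x s. f e x + s" and q = "pcompose q [:1, 1:]"])
    show "fp (\<lambda>p. f (fst p) (fst (snd p)) + snd (snd p))"
      by (intro fp_add fp_comp2[OF assms(1)] fp_fst fp_snd fp_id)
    show "len (f e x + s) \<le> len s + poly (pcompose q [:1, 1:]) (len e + len x)" for e x s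
      using q[of "(e, x)"] len_add_carry[of "f e x" s False] by (simp add: poly_pcompose)
  qed (simp_all add: assms fp_const)
  moreover have "fold (\<lambda>x s. f e x + s) xs y = sum_list (map (f e) xs) + y" for e xs y
    by (induction xs arbitrary: y) simp_all
  ultimately show ?thesis by simp
qed

section \<open>From polynomial-time functions to the class P\<close>

text \<open>The tape holds a bare row of symbols, while the code of a list ends with the symbol of
  the empty list. So the code is built from the last bit on, after the input has been reversed onto
  stack 1. Each loop stops at a blank.\<close>

definition convert_input :: cmd where
  "convert_input =
     Loop 0 (\<lambda>x. x \<noteq> 0) (Cond 0 (\<lambda>x. x = 2) (push 1 2) (push 1 1) ;; Drop 0) ;; push 0 1 ;;
     Loop 1 (\<lambda>x. x \<noteq> 0)
       (Cond 1 (\<lambda>x. x = 2) (push 0 1 ;; push 0 1 ;; push 0 2) (push 0 1) ;; push 0 2 ;; Drop 1)"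

abbreviation symbols_of :: "bool list \<Rightarrow> nat list" where
  "symbols_of \<equiv> map (\<lambda>b. if b then 2 else 1)"

lemma runs_convert_input:
  "runs convert_input (stacks (symbols_of x) [] [] []) (10 + 40 * length x) (stacks (code x) [] [] [])"
proof -
  let ?A = "Cond 0 (\<lambda>x. x = 2) (push 1 2) (push 1 1) ;; Drop 0"
  let ?B = "Cond 1 (\<lambda>x. x = 2) (push 0 1 ;; push 0 1 ;; push 0 2) (push 0 1) ;; push 0 2 ;; Drop 1"
  have A: "runs (Loop 0 (\<lambda>x. x \<noteq> 0) ?A) (stacks (symbols_of x) b [] []) (1 + 7 * length x)
      (stacks [] (rev (symbols_of x) @ b) [] [])" for b
  proof (induction x arbitrary: b)
    case Nil
    show ?case using runs_Loop_done[of "\<lambda>x. x \<noteq> 0" "stacks [] b [] []" 0 ?A] by simp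
  next
    case (Cons y x)
    define v :: nat where "v = (if y then 2 else 1)"
    have "runs (if v = 2 then push 1 2 else push 1 1) (stacks (v # symbols_of x) b [] []) 3
        (stacks (v # symbols_of x) (v # b) [] [])"
      unfolding v_def by (cases y) (use runs_push_stacks(2) in simp_all)
    then have "runs (Cond 0 (\<lambda>x. x = 2) (push 1 2) (push 1 1)) (stacks (v # symbols_of x) b [] []) (Suc 3)
        (stacks (v # symbols_of x) (v # b) [] [])"
      by (intro runs_Cond) simp
    note 1 = runs_Seq[OF this runs_Drop_stacks(1)]
    have "runs (Loop 0 (\<lambda>x. x \<noteq> 0) ?A) (stacks (v # symbols_of x) b [] [])
        (Suc (Suc (Suc 3 + 1) + (1 + 7 * length x))) (stacks [] (rev (symbols_of x) @ v # b) [] [])"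
      by (rule runs_Loop_step[OF _ 1 Cons]) (simp add: v_def)
    from runs_mono[OF this, of "1 + 7 * length (y # x)"] show ?case by (simp add: v_def)
  qed
  have B: "runs (Loop 1 (\<lambda>x. x \<noteq> 0) ?B) (stacks (code l) (symbols_of y) [] []) (1 + 22 * length y)
      (stacks (code (rev y @ l)) [] [] [])" for y l
  proof (induction y arbitrary: l)
    case Nil
    show ?case using runs_Loop_done[of "\<lambda>x. x \<noteq> 0" "stacks (code l) [] [] []" 1 ?B] by simp
  next
    case (Cons z y)
    define v :: nat where "v = (if z then 2 else 1)"
    have "runs (if v = 2 then push 0 1 ;; push 0 1 ;; push 0 2 else push 0 1) (stacks (code l) (v # symbols_of y) [] []) 12
        (stacks (code z @ code l) (v # symbols_of y) [] [])"
    proof (cases z)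
      case True
      then show ?thesis
        using runs_mono[OF runs_Seq[OF runs_push_stacks(1) runs_Seq[OF runs_push_stacks(1) runs_push_stacks(1)]], of 12]
        by (simp add: v_def)
    next
      case False
      then show ?thesis using runs_mono[OF runs_push_stacks(1), of 12] by (simp add: v_def)
    qed
    then have "runs (Cond 1 (\<lambda>x. x = 2) (push 0 1 ;; push 0 1 ;; push 0 2) (push 0 1)) (stacks (code l) (v # symbols_of y) [] []) (Suc 12)
        (stacks (code z @ code l) (v # symbols_of y) [] [])"
      by (intro runs_Cond) simp
    moreover have "runs (Drop 1) (stacks (2 # code z @ code l) (v # symbols_of y) [] []) 1 (stacks (code (z # l)) (symbols_of y) [] [])"
      by (rule runs_Drop) simp
    then have "runs (push 0 2 ;; Drop 1) (stacks (code z @ code l) (v # symbols_of y) [] []) (Suc (3 + 1))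
        (stacks (code (z # l)) (symbols_of y) [] [])"
      by (rule runs_Seq[OF runs_push_stacks(1)])
    ultimately have 1: "runs ?B (stacks (code l) (v # symbols_of y) [] []) (Suc (Suc 12 + Suc (3 + 1)))
        (stacks (code (z # l)) (symbols_of y) [] [])"
      by (rule runs_Seq)
    have "runs (Loop 1 (\<lambda>x. x \<noteq> 0) ?B) (stacks (code l) (v # symbols_of y) [] [])
        (Suc (Suc (Suc 12 + Suc (3 + 1)) + (1 + 22 * length y))) (stacks (code (rev y @ z # l)) [] [] [])"
      by (rule runs_Loop_step[OF _ 1 Cons]) (simp add: v_def)
    from runs_mono[OF this, of "1 + 22 * length (z # y)"] show ?case by (simp add: v_def)
  qed
  have "runs (Loop 1 (\<lambda>x. x \<noteq> 0) ?B) (stacks [1] (rev (symbols_of x) @ []) [] []) (1 + 22 * length x)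
      (stacks (code x) [] [] [])"
    using B[of "[]" "rev x"] by (simp add: rev_map)
  from runs_Seq[OF A runs_Seq[OF runs_push_stacks(1) this]] show ?thesis
    unfolding convert_input_def by (rule runs_mono) simp
qed

lemma len_bools: "len (x :: bool list) \<le> 1 + 4 * length x"
proof (induction x)
  case (Cons b x)
  then show ?case using len_bool[of b] by simp
qed simp

lemma fp_class_P:
  assumes "fp D"
  shows "{x. D x} \<in> class_P"
proof -
  obtain P p where P: "ok P" "\<And>x r b c d.
      runs P (stacks (code x @ r) b c d) (poly p (len x)) (stacks (code (D x) @ r) b c d)"
    using assms unfolding fp_def by blast
  have "poly_bounded (\<lambda>n. Suc (10 + 40 * n + poly p (1 + 4 * n)))"
    unfolding Suc_eq_plus1 by (intro poly_bounded_intros)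
  then obtain q where q: "\<And>n. Suc (10 + 40 * n + poly p (1 + 4 * n)) \<le> poly q n"
    unfolding poly_bounded_def by blast
  show ?thesis
  proof (rule class_P_I)
    show "ok (convert_input ;; P)" using P by (simp add: convert_input_def)
    show "\<exists>t \<le> poly q (length x). \<exists>s. (sstep ^^ t) ([convert_input ;; P], input_store x) = ([], s) \<and>
        (peek (s 0) = 2 \<longleftrightarrow> x \<in> {x. D x})" for x
    proof -
      have "runs P (stacks (code x) [] [] []) (poly p (1 + 4 * length x)) (stacks (code (D x)) [] [] [])"
        using runs_mono[OF P(2)[of x "[]" "[]" "[]" "[]"] poly_nat_mono[OF len_bools]] by simp
      from runs_mono[OF runs_Seq[OF runs_convert_input this] q]
      have "runs (convert_input ;; P) (stacks (symbols_of x) [] [] []) (poly q (length x))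
          (stacks (code (D x)) [] [] [])" .
      moreover have "input_store x = stacks (symbols_of x) [] [] []"
        by (auto simp: input_store_def stacks_def fun_eq_iff)
      moreover have "peek (stacks (code (D x)) [] [] [] 0) = 2 \<longleftrightarrow> x \<in> {x. D x}"
        by (cases "D x") simp_all
      ultimately show ?thesis unfolding runs_def by metis
    qed
  qed
qed


section \<open>Parsing\<close>

text \<open>A list with at most one entry plays the part of an option. Besides completeness and
  soundness, value and remainder together must be shorter than the input; this keeps the state of
  \<open>parse_list\<close> from growing by more than a constant per round.\<close>

definition parses :: "(bool list \<Rightarrow> ('a::encodable \<times> bool list) list) \<Rightarrow> ('a \<Rightarrow> bool list) \<Rightarrow> bool" where
  "parses p f \<longleftrightarrow> fp p \<and> (\<forall>a r. p (f a @ r) = [(a, r)]) \<and>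
     (\<forall>s. p s = [] \<or> (\<exists>a r. p s = [(a, r)] \<and> s = f a @ r)) \<and>
     (\<forall>a r. len a + len r < len (f a @ r))"

lemma parsesD:
  assumes "parses p f"
  shows "fp p" "p (f a @ r) = [(a, r)]" "len a + len r < len (f a @ r)"
    "p s = [] \<or> (\<exists>a r. p s = [(a, r)] \<and> s = f a @ r)"
  using assms unfolding parses_def by blast+

definition parse_pair ::
  "(bool list \<Rightarrow> ('a \<times> bool list) list) \<Rightarrow> (bool list \<Rightarrow> ('b \<times> bool list) list) \<Rightarrow>
   bool list \<Rightarrow> (('a \<times> 'b) \<times> bool list) list" where
  "parse_pair p q s =
     (case p s of [] \<Rightarrow> [] | y # _ \<Rightarrow>
       (case q (snd y) of [] \<Rightarrow> [] | z # _ \<Rightarrow> [((fst y, fst z), snd z)]))"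

lemma parses_pair:
  assumes p: "parses p f" and q: "parses q g"
  shows "parses (parse_pair p q) (\<lambda>x. f (fst x) @ g (snd x))"
  unfolding parses_def
proof (intro conjI allI)
  have fp: "fp (\<lambda>x. q (h x))" if "fp h" for h :: "'c::encodable \<Rightarrow> bool list"
    using fp_comp[OF that parsesD(1)[OF q]] .
  show "fp (parse_pair p q)"
    unfolding parse_pair_def[abs_def]
    by (rule fp_case_list[OF parsesD(1)[OF p] fp_const fp_case_list[OF fp fp_const]])
      (intro fp_intros)+
  show "parse_pair p q ((f (fst x) @ g (snd x)) @ r) = [(x, r)]" for x r
    by (simp add: parse_pair_def parsesD(2)[OF p] parsesD(2)[OF q])
  show "parse_pair p q s = [] \<or>
      (\<exists>a r. parse_pair p q s = [(a, r)] \<and> s = (f (fst a) @ g (snd a)) @ r)" for s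
  proof (cases "p s = []")
    case True
    then show ?thesis by (simp add: parse_pair_def)
  next
    case False
    then obtain a r where a: "p s = [(a, r)]" "s = f a @ r" using parsesD(4)[OF p] by blast
    then show ?thesis
      using parsesD(4)[OF q, of r] by (auto simp: parse_pair_def)
  qed
  show "len x + len r < len ((f (fst x) @ g (snd x)) @ r)" for x r
    using parsesD(3)[OF p, of "fst x" "g (snd x) @ r"] parsesD(3)[OF q, of "snd x" r]
    by (cases x) simp
qed

definition parse_bit :: "bool list \<Rightarrow> (bool \<times> bool list) list" where
  "parse_bit s = (case s of [] \<Rightarrow> [] | b # r \<Rightarrow> [(b, r)])"

lemma parses_bit: "parses parse_bit (\<lambda>b. [b])"
  unfolding parses_def
proof (intro conjI allI)
  show "fp parse_bit" unfolding parse_bit_def[abs_def] by (intro fp_intros)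
  show "parse_bit s = [] \<or> (\<exists>a r. parse_bit s = [(a, r)] \<and> s = [a] @ r)" for s
    by (cases s) (simp_all add: parse_bit_def)
qed (simp_all add: parse_bit_def)

lemma len_append_Suc: "Suc (len (xs @ ys)) = len xs + len ys"
  by (induction xs) simp_all

lemma len_rev: "len (rev xs) = len xs"
proof (induction xs)
  case (Cons x xs)
  then show ?case using len_append_Suc[of "rev xs" "[x]"] by simp
qed simp

text \<open>
  The first component of the state is the result, if there is one. The second one holds the
  elements read so far, in reverse order, and the remaining input; it is empty after the end.
\<close>

definition list_step ::
  "(bool list \<Rightarrow> ('a \<times> bool list) list) \<Rightarrow> ('a list \<times> bool list) list \<times> ('a list \<times> bool list) list \<Rightarrow>
   ('a list \<times> bool list) list \<times> ('a list \<times> bool list) list" where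
  "list_step p s =
     (case snd s of [] \<Rightarrow> s | y # _ \<Rightarrow>
       (case snd y of [] \<Rightarrow> (fst s, []) | b # r \<Rightarrow>
          if b then (case p r of [] \<Rightarrow> (fst s, []) | z # _ \<Rightarrow> (fst s, [(fst z # fst y, snd z)]))
          else ([(rev (fst y), r)], [])))"

text \<open>The input also serves as the clock: every round that continues the parse consumes at
  least one of its bits, so its length bounds the number of rounds.\<close>

definition parse_list :: "(bool list \<Rightarrow> ('a \<times> bool list) list) \<Rightarrow> bool list \<Rightarrow> ('a list \<times> bool list) list" where
  "parse_list p s = fst (fold (\<lambda>_. list_step p) s ([], [([], s)]))"

lemma list_step_simps:
  "list_step p (res, []) = (res, [])"
  "list_step p (res, [(out, False # r)]) = ([(rev out, r)], [])"
  "p r = [(a, r')] \<Longrightarrow> list_step p (res, [(out, True # r)]) = (res, [(a # out, r')])"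
  by (simp_all add: list_step_def)

lemma enc_list_Nil: "enc_list f [] = [False]"
  by (simp add: enc_list_def)

lemma enc_list_Cons: "enc_list f (x # xs) = True # f x @ enc_list f xs"
  by (simp add: enc_list_def)

lemma parses_list:
  fixes f :: "'a::encodable \<Rightarrow> bool list"
  assumes p: "parses p f"
  shows "parses (parse_list p) (enc_list f)"
  unfolding parses_def
proof (intro conjI allI)
  let ?run = "fold (\<lambda>_ :: bool. list_step p)"
  have fp: "fp (\<lambda>x. p (h x))" if "fp h" for h :: "'c::encodable \<Rightarrow> bool list"
    using fp_comp[OF that parsesD(1)[OF p]] .
  have step: "fp (\<lambda>x :: bool list \<times> bool \<times> ('a list \<times> bool list) list \<times> ('a list \<times> bool list) list.
      list_step p (snd (snd x)))"
    unfolding list_step_def by (intro fp_intros fp_rev fp)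
  have "fp (\<lambda>s. ?run s ([], [([], s)]))"
  proof (rule fp_fold[where g = "\<lambda>_ _. list_step p" and q = "[:10:]", OF _ _ step])
    show "len (list_step p s) \<le> len s + poly [:10:] (len e + len x)" for e :: "bool list" and x :: bool and s
    proof (cases "\<exists>res out r ys. s = (res, (out, True # r) # ys) \<and> p r \<noteq> []")
      case True
      then obtain res out r ys where s: "s = (res, (out, True # r) # ys)" "p r \<noteq> []" by blast
      then obtain a r' where a: "p r = [(a, r')]" "r = f a @ r'" using parsesD(4)[OF p] by blast
      \<comment> \<open>The new element and the remainder together are shorter than the
        \<open>r\<close> from which they were read.\<close>
      then show ?thesis using parsesD(3)[OF p, of a r'] by (simp add: s list_step_def)
    next
      case False
      then show ?thesis
        by (cases s) (auto simp: list_step_def len_rev split: list.splits)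
    qed
  qed (intro fp_intros)+
  then show "fp (parse_list p)" unfolding parse_list_def[abs_def] by (rule fp_fst)
  have idle: "?run s (res, []) = (res, [])" for s res
    by (induction s) (simp_all add: list_step_simps)
  \<comment> \<open>One round per element and one for the end mark, hence the strict
    inequality.\<close>
  have complete: "?run s (res, [(out, enc_list f xs @ r)]) = ([(rev out @ xs, r)], [])"
    if "length xs < length s" for s res out xs r
    using that
  proof (induction xs arbitrary: s out)
    case Nil
    then show ?case by (cases s) (simp_all add: enc_list_Nil list_step_simps idle)
  next
    case (Cons x xs)
    then show ?case
      by (cases s) (simp_all add: enc_list_Cons
          list_step_simps(3)[of p "f x @ enc_list f xs @ r" x "enc_list f xs @ r", OF parsesD(2)[OF p]])
  qed
  show "parse_list p (enc_list f xs @ r) = [(xs, r)]" for xs r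
  proof -
    have "length xs < length (enc_list f xs)"
      by (induction xs) (simp_all add: enc_list_Nil enc_list_Cons)
    then show ?thesis by (simp add: parse_list_def complete idle)
  qed
  show "parse_list p s = [] \<or> (\<exists>a r. parse_list p s = [(a, r)] \<and> s = enc_list f a @ r)" for s
  proof -
    \<comment> \<open>A result has to encode an initial part of the input; a pending state splits
      the input into the elements read and the rest.\<close>
    let ?inv = "\<lambda>z. (fst z = [] \<or> (\<exists>a r. fst z = [(a, r)] \<and> s = enc_list f a @ r)) \<and>
      (snd z = [] \<or> (\<exists>out r. snd z = [(out, r)] \<and> s = concat (map (\<lambda>x. True # f x) (rev out)) @ r))"
    have inv: "?inv (list_step p z)" if z: "?inv z" for z
    proof (cases "snd z = []")
      case True
      with z show ?thesis by (simp add: list_step_def)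
    next
      case False
      with z obtain out t where t: "snd z = [(out, t)]" "s = concat (map (\<lambda>x. True # f x) (rev out)) @ t"
        by blast
      consider "t = []" | r where "t = False # r" | r where "t = True # r" by (metis (full_types) neq_Nil_conv)
      then show ?thesis
      proof cases
        case 1
        with z t show ?thesis by (simp add: list_step_def)
      next
        case 2
        with t show ?thesis by (simp add: list_step_def enc_list_def)
      next
        case 3
        show ?thesis
          using parsesD(4)[OF p, of r]
        proof
          assume "p r = []"
          with 3 z t show ?thesis by (simp add: list_step_def)
        next
          assume "\<exists>a r'. p r = [(a, r')] \<and> r = f a @ r'"
          then obtain a r' where "p r = [(a, r')]" "r = f a @ r'" by blast
          with 3 z t show ?thesis by (simp add: list_step_def)
        qed
      qed
    qed
    have "?inv (?run u z)" if "?inv z" for u z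
      using that
    proof (induction u arbitrary: z)
      case (Cons b u)
      show ?case using Cons.IH[OF inv[OF Cons.prems]] by simp
    qed simp
    from this[of "([], [([], s)])" s] show ?thesis unfolding parse_list_def by simp
  qed
  show "len xs + len r < len (enc_list f xs @ r)" for xs r
  proof (induction xs)
    case (Cons x xs)
    then show ?case using parsesD(3)[OF p, of x "enc_list f xs @ r"] by (simp add: enc_list_Cons)
  qed (simp add: enc_list_Nil)
qed

fun nat_of_bits :: "bool list \<Rightarrow> nat" where
  "nat_of_bits [] = 0"
| "nat_of_bits (b # bs) = of_bool b + 2 * nat_of_bits bs"

text \<open>Digit lists with most significant digit 0 encode no number and must be rejected, since
  the language contains exact encodings only. Reversal gives access to that digit.\<close>

definition canonical :: "bool list \<Rightarrow> bool" where
  "canonical bs \<longleftrightarrow> (case rev bs of [] \<Rightarrow> True | b # _ \<Rightarrow> b)"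

lemma canonical_iff: "canonical bs \<longleftrightarrow> bs = [] \<or> last bs"
  by (cases bs rule: rev_cases) (simp_all add: canonical_def)

lemma nat_of_bits_bits: "nat_of_bits (bits n) = n"
proof (induction n rule: less_induct)
  case (less n)
  show ?case
  proof (cases "n = 0")
    case False
    then show ?thesis using less[of "n div 2"] by (simp add: bits_pos)
  qed (simp add: bits_0)
qed

lemma canonical_bits: "canonical (bits n)"
proof (induction n rule: less_induct)
  case (less n)
  show ?case
  proof (cases "n \<le> 1")
    case True
    then have "n = 0 \<or> n = 1" by auto
    then show ?thesis by (auto simp: bits_0 bits_pos canonical_iff)
  next
    case False
    then show ?thesis using less[of "n div 2"] by (auto simp: bits_pos canonical_iff)
  qed
qed

lemma bits_nat_of_bits: "canonical bs \<Longrightarrow> bits (nat_of_bits bs) = bs"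
proof (induction bs)
  case (Cons b bs)
  then have IH: "bits (nat_of_bits bs) = bs" by (auto simp: canonical_iff split: if_splits)
  have "b \<or> bs \<noteq> []" using Cons.prems by (auto simp: canonical_iff)
  with IH have "b \<or> nat_of_bits bs \<noteq> 0" using bits_0 by metis
  with IH show ?case by (subst bits_pos) auto
qed (simp add: bits_0)

definition parse_nat :: "bool list \<Rightarrow> (nat \<times> bool list) list" where
  "parse_nat s =
     (case parse_list parse_bit s of [] \<Rightarrow> [] | y # _ \<Rightarrow>
        if canonical (fst y) then [(nat_of_bits (fst y), snd y)] else [])"

text \<open>On canonical digit lists the conversion to a number leaves the code unchanged, so
  \<open>nat_of_bits\<close> never has to be computed.\<close>

lemma parses_nat: "parses parse_nat enc_nat"
proof -
  note p = parsesD[OF parses_list[OF parses_bit]]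
  show ?thesis unfolding parses_def
  proof (intro conjI allI)
    have "fp (\<lambda>s. case parse_list parse_bit s of [] \<Rightarrow> [] | y # _ \<Rightarrow>
        if canonical (fst y) then [(fst y, snd y)] else [])"
      unfolding canonical_def
      by (rule fp_case_list[OF p(1) fp_const]) (intro fp_intros fp_rev)
    then show "fp parse_nat"
      by (rule fp_cong) (auto simp: parse_nat_def bits_nat_of_bits simp flip: code_bits split: list.splits)
    show "parse_nat (enc_nat n @ r) = [(n, r)]" for n r
      by (simp add: parse_nat_def enc_nat_def p(2) canonical_bits nat_of_bits_bits)
    show "parse_nat s = [] \<or> (\<exists>a r. parse_nat s = [(a, r)] \<and> s = enc_nat a @ r)" for s
      using p(4)[of s] by (auto simp: parse_nat_def enc_nat_def bits_nat_of_bits)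
    show "len n + len r < len (enc_nat n @ r)" for n r
      using p(3)[of "bits n" r] by (simp add: enc_nat_def)
  qed
qed

section \<open>Support matrices\<close>

text \<open>Filtering takes the place of comparing positions, so that the closure rules for lists
  apply.\<close>

definition comes_first :: "vote \<Rightarrow> cand \<Rightarrow> cand \<Rightarrow> bool" where
  "comes_first v c d \<longleftrightarrow> (case filter (\<lambda>x. x = c \<or> x = d) v of [] \<Rightarrow> False | y # _ \<Rightarrow> y = c)"

lemma comes_first_iff: "c \<noteq> d \<Longrightarrow> comes_first v c d \<longleftrightarrow> prefers v c d"
  by (induction v) (auto simp: comes_first_def prefers_def position_def)

text \<open>The binary weights are added directly, as the list \<open>unweighted W\<close> may have
  exponential length.\<close>

definition weighted_support :: "(vote \<times> nat) list \<Rightarrow> cand \<Rightarrow> cand \<Rightarrow> nat" where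
  "weighted_support W c d = (\<Sum>x\<leftarrow>W. if comes_first (fst x) c d then snd x else 0)"

lemma support_append: "support (U @ V) c d = support U c d + support V c d"
  by (simp add: support_def)

lemma support_replicate: "support (replicate k v) c d = (if prefers v c d then k else 0)"
  by (simp add: support_def)

lemma support_unweighted: "c \<noteq> d \<Longrightarrow> support (unweighted W) c d = weighted_support W c d"
proof (induction W)
  case (Cons x W)
  then show ?case
    by (cases x) (simp add: unweighted_def weighted_support_def support_append support_replicate
        comes_first_iff)
qed (simp add: unweighted_def weighted_support_def support_def)

lemma set_unweighted: "set (unweighted W) \<subseteq> fst ` set W"
  by (force simp: unweighted_def)

lemma prefers_total:
  assumes "is_vote C v" "c \<in> C" "d \<in> C" "c \<noteq> d"
  shows "prefers v d c \<longleftrightarrow> \<not> prefers v c d"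
proof -
  have "set v = C" using assms(1) by (simp add: is_vote_def)
  moreover have "c \<in> set v \<Longrightarrow> d \<in> set v \<Longrightarrow> position v c \<noteq> position v d"
    using assms(4) by (induction v) (auto simp: position_def)
  ultimately show ?thesis using assms(2,3) by (auto simp: prefers_def)
qed

lemma support_total:
  assumes "\<forall>v \<in> set V. is_vote C v" "c \<in> C" "d \<in> C" "c \<noteq> d"
  shows "support V c d + support V d c = length V"
  using assms(1)
proof (induction V)
  case (Cons v V)
  then show ?case using prefers_total[of C v c d] assms(2-4) by (simp add: support_def)
qed (simp add: support_def)

lemma card_prefers:
  "distinct v \<Longrightarrow> c \<in> set v \<Longrightarrow>
   int (card {d \<in> set v - {c}. prefers v c d}) = int (length v) - 1 - int (position v c)"
proof (induction v)
  case (Cons x v)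
  show ?case
  proof (cases "x = c")
    case True
    then have eq: "{d \<in> set (x # v) - {c}. prefers (x # v) c d} = set v"
      using Cons.prems by (auto simp: prefers_def position_def)
    show ?thesis unfolding eq using True Cons.prems by (simp add: position_def distinct_card)
  next
    case False
    then have "{d \<in> set (x # v) - {c}. prefers (x # v) c d} = {d \<in> set v - {c}. prefers v c d}"
      using Cons.prems by (auto simp: prefers_def position_def)
    then show ?thesis using False Cons by (simp add: position_def)
  qed
qed simp

lemma borda_support:
  assumes "\<forall>v \<in> set V. is_vote C v" "c \<in> C" "finite C"
  shows "borda C V c = (\<Sum>d \<in> C - {c}. int (support V c d))"
  using assms(1)
proof (induction V)
  case (Cons v V)
  then have v: "distinct v" "set v = C" by (auto simp: is_vote_def)
  have "int (card C) - 1 - int (position v c) = int (card {d \<in> C - {c}. prefers v c d})"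
    using card_prefers[OF v(1), of c] distinct_card[OF v(1)] assms(2) unfolding v(2) by simp
  also have "\<dots> = (\<Sum>d \<in> C - {c}. of_bool (prefers v c d))"
  proof -
    have "{d \<in> C - {c}. prefers v c d} = (C - {c}) \<inter> {d. prefers v c d}" by auto
    then show ?thesis using assms(3) by (simp add: sum_of_bool_eq)
  qed
  finally have "int (card C) - 1 - int (position v c) = (\<Sum>d \<in> C - {c}. of_bool (prefers v c d))" .
  moreover have "int (support (v # V) c d) = of_bool (prefers v c d) + int (support V c d)" for d
    by (simp add: support_def)
  ultimately show ?case using Cons by (simp add: borda_def sum.distrib)
qed (simp add: borda_def support_def)

section \<open>Comparing points through pairwise supports\<close>

type_synonym comparison = "(cand \<Rightarrow> cand \<Rightarrow> nat) \<Rightarrow> cand list \<Rightarrow> cand \<Rightarrow> cand \<Rightarrow> bool"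

definition borda_beats :: comparison where
  "borda_beats S cs c h \<longleftrightarrow>
     (\<Sum>d\<leftarrow>filter (\<lambda>d. d \<noteq> h) cs. S h d) < (\<Sum>d\<leftarrow>filter (\<lambda>d. d \<noteq> c) cs. S c d)"

text \<open>Wins minus losses of \<open>h\<close> against wins minus losses of \<open>c\<close>,
  with the losses moved to the other side so that addition of natural numbers suffices.\<close>

definition copeland_beats :: comparison where
  "copeland_beats S cs c h \<longleftrightarrow>
     (\<Sum>d\<leftarrow>filter (\<lambda>d. d \<noteq> h) cs. if S d h < S h d then 1 else 0) +
     (\<Sum>d\<leftarrow>filter (\<lambda>d. d \<noteq> c) cs. if S c d < S d c then 1 else 0) <
     (\<Sum>d\<leftarrow>filter (\<lambda>d. d \<noteq> c) cs. if S d c < S c d then 1 else (0 :: nat)) +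
     (\<Sum>d\<leftarrow>filter (\<lambda>d. d \<noteq> h) cs. if S h d < S d h then 1 else 0)"

text \<open>One minimum lies below another iff some member of the first set lies below all members
  of the second, so no minimum has to be computed.\<close>

definition maximin_beats :: comparison where
  "maximin_beats S cs c h \<longleftrightarrow>
     list_ex (\<lambda>d. d \<noteq> h \<and> list_all (\<lambda>e. e = c \<or> S h d < S c e) cs) cs"

definition expresses :: "comparison \<Rightarrow> protocol \<Rightarrow> bool" where
  "expresses beats score \<longleftrightarrow> (\<forall>W cs c h. distinct cs \<longrightarrow> c \<in> set cs \<longrightarrow> h \<in> set cs \<longrightarrow> c \<noteq> h \<longrightarrow>
     (\<forall>x \<in> set W. is_vote (set cs) (fst x)) \<longrightarrow>
     (score (set cs) (unweighted W) h < score (set cs) (unweighted W) c \<longleftrightarrow>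
        beats (weighted_support W) cs c h))"

lemma sum_filter_neq:
  "distinct cs \<Longrightarrow> (\<Sum>d\<leftarrow>filter (\<lambda>d. d \<noteq> c) cs. f d) = (\<Sum>d \<in> set cs - {c}. f d)"
  by (subst sum_list_distinct_conv_sum_set) (auto intro: sum.cong)

lemma expresses_borda: "expresses borda_beats borda"
  unfolding expresses_def
proof (intro allI impI)
  fix W :: "(vote \<times> nat) list" and cs c h
  assume a: "distinct cs" "c \<in> set cs" "h \<in> set cs" "c \<noteq> h"
    "\<forall>x \<in> set W. is_vote (set cs) (fst x)"
  have V: "\<forall>v \<in> set (unweighted W). is_vote (set cs) v" using set_unweighted[of W] a(5) by blast
  have "borda (set cs) (unweighted W) c = int (\<Sum>d\<leftarrow>filter (\<lambda>d. d \<noteq> c) cs. weighted_support W c d)"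
    if "c \<in> set cs" for c
    unfolding sum_filter_neq[OF a(1)] borda_support[OF V that finite_set]
    by (simp add: support_unweighted)
  with a show "borda (set cs) (unweighted W) h < borda (set cs) (unweighted W) c \<longleftrightarrow>
      borda_beats (weighted_support W) cs c h"
    unfolding borda_beats_def by simp
qed

lemma expresses_copeland: "expresses copeland_beats copeland"
  unfolding expresses_def
proof (intro allI impI)
  fix W :: "(vote \<times> nat) list" and cs c h
  assume a: "distinct cs" "c \<in> set cs" "h \<in> set cs" "c \<noteq> h"
    "\<forall>x \<in> set W. is_vote (set cs) (fst x)"
  let ?S = "weighted_support W"
  have V: "\<forall>v \<in> set (unweighted W). is_vote (set cs) v" using set_unweighted[of W] a(5) by blast
  \<comment> \<open>The supports of two candidates against each other sum to the number of votes, so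
    more than half means more than the opponent.\<close>
  have defeats: "defeats (unweighted W) c d \<longleftrightarrow> ?S d c < ?S c d"
    if "c \<in> set cs" "d \<in> set cs" "c \<noteq> d" for c d
    using support_total[OF V that] that
    by (auto simp: defeats_def support_unweighted)
  have "copeland (set cs) (unweighted W) c =
      int (\<Sum>d\<leftarrow>filter (\<lambda>d. d \<noteq> c) cs. if ?S d c < ?S c d then 1 else 0) -
      int (\<Sum>d\<leftarrow>filter (\<lambda>d. d \<noteq> c) cs. if ?S c d < ?S d c then 1 else 0)"
    if "c \<in> set cs" for c
    unfolding sum_filter_neq[OF a(1)] copeland_def of_nat_sum sum_subtractf[symmetric]
    by (rule sum.cong) (use that defeats[of c] defeats[of _ c] in auto)
  with a show "copeland (set cs) (unweighted W) h < copeland (set cs) (unweighted W) c \<longleftrightarrow>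
      copeland_beats ?S cs c h"
    unfolding copeland_beats_def by auto
qed

lemma expresses_maximin: "expresses maximin_beats maximin"
  unfolding expresses_def
proof (intro allI impI)
  fix W :: "(vote \<times> nat) list" and cs c h
  assume a: "distinct cs" "c \<in> set cs" "h \<in> set cs" "c \<noteq> h"
    "\<forall>x \<in> set W. is_vote (set cs) (fst x)"
  let ?S = "weighted_support W"
  have "maximin (set cs) (unweighted W) c = int (Min (?S c ` (set cs - {c})))" for c
    unfolding maximin_def by (simp add: support_unweighted)
  moreover have "Min A < Min B \<longleftrightarrow> (\<exists>x \<in> A. \<forall>y \<in> B. x < y)"
    if "finite A" "A \<noteq> {}" "finite B" "B \<noteq> {}" for A B :: "nat set"
    by (subst Min_less_iff) (use that in simp_all)
  note this[of "?S h ` (set cs - {h})" "?S c ` (set cs - {c})"]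
  \<comment> \<open>Since \<open>c\<close> and \<open>h\<close> differ, each has an opponent, and
    the unspecified minimum of the empty set does not arise.\<close>
  moreover have "?S h ` (set cs - {h}) \<noteq> {}" "?S c ` (set cs - {c}) \<noteq> {}" using a by auto
  ultimately show "maximin (set cs) (unweighted W) h < maximin (set cs) (unweighted W) c \<longleftrightarrow>
      maximin_beats ?S cs c h"
    by (auto simp: maximin_beats_def list_ex_iff list_all_iff)
qed

section \<open>The optimal manipulation\<close>

text \<open>Supports among the other candidates are left free, so the manipulators may rank these in
  any order; \<open>best_vote\<close> keeps the order of the candidate list.\<close>

definition improves ::
  "(cand \<Rightarrow> cand \<Rightarrow> nat) \<Rightarrow> (cand \<Rightarrow> cand \<Rightarrow> nat) \<Rightarrow> cand list \<Rightarrow> cand \<Rightarrow> cand \<Rightarrow> bool" where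
  "improves S S' cs c h \<longleftrightarrow>
     (\<forall>d \<in> set cs - {c}. S c d \<le> S' c d \<and> S' d c \<le> S d c) \<and>
     (\<forall>d \<in> set cs - {h}. S' h d \<le> S h d \<and> S d h \<le> S' d h)"

definition monotone_comparison :: "comparison \<Rightarrow> bool" where
  "monotone_comparison beats \<longleftrightarrow>
     (\<forall>S S' cs c h. improves S S' cs c h \<longrightarrow> beats S cs c h \<longrightarrow> beats S' cs c h)"

lemma monotone_borda: "monotone_comparison borda_beats"
  unfolding monotone_comparison_def
proof (intro allI impI)
  fix S S' cs c h
  assume i: "improves S S' cs c h" and b: "borda_beats S cs c h"
  have "(\<Sum>d\<leftarrow>filter (\<lambda>d. d \<noteq> h) cs. S' h d) \<le> (\<Sum>d\<leftarrow>filter (\<lambda>d. d \<noteq> h) cs. S h d)"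
    "(\<Sum>d\<leftarrow>filter (\<lambda>d. d \<noteq> c) cs. S c d) \<le> (\<Sum>d\<leftarrow>filter (\<lambda>d. d \<noteq> c) cs. S' c d)"
    using i by (auto intro!: sum_list_mono simp: improves_def)
  with b show "borda_beats S' cs c h" unfolding borda_beats_def by linarith
qed

lemma monotone_copeland: "monotone_comparison copeland_beats"
  unfolding monotone_comparison_def
proof (intro allI impI)
  fix S S' cs c h
  assume i: "improves S S' cs c h" and b: "copeland_beats S cs c h"
  have count_mono: "(\<Sum>d\<leftarrow>filter (\<lambda>d. d \<noteq> a) cs. if P d then 1 else 0) \<le>
      (\<Sum>d\<leftarrow>filter (\<lambda>d. d \<noteq> a) cs. if Q d then 1 else (0 :: nat))"
    if "\<And>d. d \<in> set cs - {a} \<Longrightarrow> P d \<Longrightarrow> Q d" for P Q a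
    by (rule sum_list_mono) (use that in auto)
  have h: "S' h d \<le> S h d" "S d h \<le> S' d h" if "d \<in> set cs - {h}" for d
    using i that unfolding improves_def by blast+
  have c: "S c d \<le> S' c d" "S' d c \<le> S d c" if "d \<in> set cs - {c}" for d
    using i that unfolding improves_def by blast+
  note count_mono[of h "\<lambda>d. S' d h < S' h d" "\<lambda>d. S d h < S h d"]
    count_mono[of c "\<lambda>d. S' c d < S' d c" "\<lambda>d. S c d < S d c"]
    count_mono[of c "\<lambda>d. S d c < S c d" "\<lambda>d. S' d c < S' c d"]
    count_mono[of h "\<lambda>d. S h d < S d h" "\<lambda>d. S' h d < S' d h"]
  moreover have "S' d h < S' h d \<Longrightarrow> S d h < S h d" "S h d < S d h \<Longrightarrow> S' h d < S' d h"
    if "d \<in> set cs - {h}" for d using h[OF that] by linarith+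
  moreover have "S' c d < S' d c \<Longrightarrow> S c d < S d c" "S d c < S c d \<Longrightarrow> S' d c < S' c d"
    if "d \<in> set cs - {c}" for d using c[OF that] by linarith+
  ultimately have
    "(\<Sum>d\<leftarrow>filter (\<lambda>d. d \<noteq> h) cs. if S' d h < S' h d then 1 else 0) \<le>
      (\<Sum>d\<leftarrow>filter (\<lambda>d. d \<noteq> h) cs. if S d h < S h d then 1 else (0 :: nat))"
    "(\<Sum>d\<leftarrow>filter (\<lambda>d. d \<noteq> c) cs. if S' c d < S' d c then 1 else 0) \<le>
      (\<Sum>d\<leftarrow>filter (\<lambda>d. d \<noteq> c) cs. if S c d < S d c then 1 else (0 :: nat))"
    "(\<Sum>d\<leftarrow>filter (\<lambda>d. d \<noteq> c) cs. if S d c < S c d then 1 else 0) \<le>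
      (\<Sum>d\<leftarrow>filter (\<lambda>d. d \<noteq> c) cs. if S' d c < S' c d then 1 else (0 :: nat))"
    "(\<Sum>d\<leftarrow>filter (\<lambda>d. d \<noteq> h) cs. if S h d < S d h then 1 else 0) \<le>
      (\<Sum>d\<leftarrow>filter (\<lambda>d. d \<noteq> h) cs. if S' h d < S' d h then 1 else (0 :: nat))"
    by blast+
  with b show "copeland_beats S' cs c h" unfolding copeland_beats_def by linarith
qed

lemma monotone_maximin: "monotone_comparison maximin_beats"
  unfolding monotone_comparison_def
proof (intro allI impI)
  fix S S' cs c h
  assume i: "improves S S' cs c h" and b: "maximin_beats S cs c h"
  then obtain d where d: "d \<in> set cs" "d \<noteq> h" "\<And>e. e \<in> set cs \<Longrightarrow> e \<noteq> c \<Longrightarrow> S h d < S c e"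
    by (auto simp: maximin_beats_def list_ex_iff list_all_iff)
  have "S' h d < S' c e" if "e \<in> set cs" "e \<noteq> c" for e
  proof -
    have "S' h d \<le> S h d" "S c e \<le> S' c e" using i d that by (auto simp: improves_def)
    with d(3)[OF that] show ?thesis by linarith
  qed
  with d(1,2) show "maximin_beats S' cs c h"
    by (auto simp: maximin_beats_def list_ex_iff list_all_iff)
qed

definition best_vote :: "cand list \<Rightarrow> cand \<Rightarrow> cand \<Rightarrow> vote" where
  "best_vote cs c h = c # filter (\<lambda>x. x \<noteq> c \<and> x \<noteq> h) cs @ [h]"

lemma is_vote_best_vote:
  "distinct cs \<Longrightarrow> c \<in> set cs \<Longrightarrow> h \<in> set cs \<Longrightarrow> c \<noteq> h \<Longrightarrow> is_vote (set cs) (best_vote cs c h)"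
  by (auto simp: is_vote_def best_vote_def)

lemma comes_first_best_vote:
  assumes "c \<noteq> h"
  shows "d \<noteq> c \<Longrightarrow> comes_first (best_vote cs c h) c d" "d \<noteq> c \<Longrightarrow> \<not> comes_first (best_vote cs c h) d c"
    "d \<in> set cs \<Longrightarrow> d \<noteq> h \<Longrightarrow> comes_first (best_vote cs c h) d h"
    "d \<in> set cs \<Longrightarrow> d \<noteq> h \<Longrightarrow> \<not> comes_first (best_vote cs c h) h d"
proof -
  show "d \<noteq> c \<Longrightarrow> comes_first (best_vote cs c h) c d" "d \<noteq> c \<Longrightarrow> \<not> comes_first (best_vote cs c h) d c"
    by (simp_all add: comes_first_def best_vote_def)
  assume d: "d \<in> set cs" "d \<noteq> h"
  have "\<exists>ys. filter (\<lambda>x. x = d \<or> x = h) (best_vote cs c h) = d # ys"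
  proof (cases "d = c")
    case True
    then show ?thesis by (simp add: best_vote_def)
  next
    case False
    let ?l = "filter (\<lambda>x. x = d \<or> x = h) (filter (\<lambda>x. x \<noteq> c \<and> x \<noteq> h) cs)"
    have l: "set ?l = {d}" using d False by auto
    obtain ys where "?l = d # ys"
    proof (cases ?l)
      case Nil
      have "d \<in> set ?l" unfolding l by simp
      then show ?thesis unfolding Nil by simp
    next
      case (Cons y ys)
      have "y \<in> set ?l" unfolding Cons by simp
      then have "y = d" unfolding l by simp
      with Cons that show ?thesis by blast
    qed
    then show ?thesis using False assms unfolding best_vote_def by (simp del: filter_filter)
  qed
  then obtain ys where "filter (\<lambda>x. x = d \<or> x = h) (best_vote cs c h) = d # ys" by blast
  moreover from this have "filter (\<lambda>x. x = h \<or> x = d) (best_vote cs c h) = d # ys"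
    by (simp add: disj_commute)
  ultimately show "comes_first (best_vote cs c h) d h" "\<not> comes_first (best_vote cs c h) h d"
    using d by (simp_all add: comes_first_def)
qed

text \<open>The comparison holds weight by weight: a vote with \<open>c\<close> before
  \<open>d\<close> contributes its full weight, one without contributes 0, and no vote can leave
  this range.\<close>

lemma weighted_support_replace:
  assumes "length vs = length ws"
  shows "comes_first v c d \<Longrightarrow>
      weighted_support (S @ zip vs ws) c d \<le> weighted_support (S @ map (Pair v) ws) c d"
    "\<not> comes_first v c d \<Longrightarrow>
      weighted_support (S @ map (Pair v) ws) c d \<le> weighted_support (S @ zip vs ws) c d"
  using assms
  by (induction vs ws rule: list_induct2) (auto simp: weighted_support_def)

definition beatable :: "comparison \<Rightarrow> cand list \<Rightarrow> (vote \<times> nat) list \<Rightarrow> nat list \<Rightarrow> cand \<Rightarrow> bool" where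
  "beatable beats cs S ws h \<longleftrightarrow>
     list_ex (\<lambda>c. c \<noteq> h \<and> beats (weighted_support (S @ map (Pair (best_vote cs c h)) ws)) cs c h) cs"

lemma manipulable_iff_beatable:
  assumes e: "expresses beats score" and m: "monotone_comparison beats" and wf: "wf_instance I"
  shows "manipulable score I \<longleftrightarrow>
    beatable beats (cands I) (cast_votes I) (open_weights I) (target I)"
proof -
  define cs S ws h where "cs = cands I" and "S = cast_votes I" and "ws = open_weights I" and "h = target I"
  note defs = this
  have cs: "distinct cs" "h \<in> set cs" and S: "\<forall>x \<in> set S. is_vote (set cs) (fst x)"
    using wf by (auto simp: wf_instance_def defs)
  have iff: "score (set cs) (unweighted W) h < score (set cs) (unweighted W) c \<longleftrightarrow>
      beats (weighted_support W) cs c h"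
    if "c \<in> set cs" "c \<noteq> h" "\<forall>x \<in> set W. is_vote (set cs) (fst x)" for W c
    using e cs that unfolding expresses_def by blast
  show ?thesis
  proof
    assume "manipulable score I"
    then obtain vs c where vs: "length vs = length ws" "\<forall>v \<in> set vs. is_vote (set cs) v"
      and c: "c \<in> set cs" "c \<noteq> h"
        "score (set cs) (unweighted (S @ zip vs ws)) h < score (set cs) (unweighted (S @ zip vs ws)) c"
      unfolding manipulable_def wins_def defs by blast
    have "\<forall>x \<in> set (S @ zip vs ws). is_vote (set cs) (fst x)"
      using S vs(2) by (auto dest: set_zip_leftD)
    then have b: "beats (weighted_support (S @ zip vs ws)) cs c h" using iff c by blast
    note first = comes_first_best_vote[OF c(2), where cs = cs]
    note replace = weighted_support_replace[OF vs(1), where v = "best_vote cs c h"]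
    have "improves (weighted_support (S @ zip vs ws))
        (weighted_support (S @ map (Pair (best_vote cs c h)) ws)) cs c h"
      unfolding improves_def using first replace by blast
    with b m have "beats (weighted_support (S @ map (Pair (best_vote cs c h)) ws)) cs c h"
      unfolding monotone_comparison_def by blast
    with c show "beatable beats (cands I) (cast_votes I) (open_weights I) (target I)"
      unfolding beatable_def defs[symmetric] by (auto simp: list_ex_iff)
  next
    assume "beatable beats (cands I) (cast_votes I) (open_weights I) (target I)"
    then obtain c where c: "c \<in> set cs" "c \<noteq> h"
      "beats (weighted_support (S @ map (Pair (best_vote cs c h)) ws)) cs c h"
      unfolding beatable_def defs[symmetric] by (auto simp: list_ex_iff)
    define vs where "vs = replicate (length ws) (best_vote cs c h)"
    have zip: "map (Pair (best_vote cs c h)) ws = zip vs ws"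
      unfolding vs_def by (induction ws) simp_all
    have v: "is_vote (set cs) (best_vote cs c h)" by (rule is_vote_best_vote[OF cs(1) c(1) cs(2) c(2)])
    have "\<forall>x \<in> set (S @ zip vs ws). is_vote (set cs) (fst x)"
      using S v unfolding zip[symmetric] by auto
    with iff c have "score (set cs) (unweighted (S @ zip vs ws)) h < score (set cs) (unweighted (S @ zip vs ws)) c"
      unfolding zip by blast
    moreover have "length vs = length ws" "\<forall>v \<in> set vs. is_vote (set cs) v"
      using v by (auto simp: vs_def)
    ultimately show "manipulable score I"
      unfolding manipulable_def wins_def defs[symmetric] using c(1,2) by blast
  qed
qed


section \<open>The decision procedure\<close>

definition member :: "nat \<Rightarrow> nat list \<Rightarrow> bool" where
  "member x xs \<longleftrightarrow> list_ex (\<lambda>y. y = x) xs"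

lemma member_iff: "member x xs \<longleftrightarrow> x \<in> set xs"
  by (auto simp: member_def list_ex_iff)

lemma fp_member: "fp a \<Longrightarrow> fp X \<Longrightarrow> fp (\<lambda>e. member (a e) (X e))"
  unfolding member_def by (intro fp_list_ex fp_eq fp_snd fp_id fp_comp[of fst a] fp_fst)

text \<open>Occurrences are counted by filtering, and the test for a single one is a nested case
  distinction, in the form covered by the closure rules.\<close>

definition all_distinct :: "nat list \<Rightarrow> bool" where
  "all_distinct xs \<longleftrightarrow>
     list_all (\<lambda>x. case filter (\<lambda>y. y = x) xs of [] \<Rightarrow> False | y # ys \<Rightarrow> (case ys of [] \<Rightarrow> True | _ # _ \<Rightarrow> False)) xs"

lemma all_distinct_iff: "all_distinct xs \<longleftrightarrow> distinct xs"
proof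
  assume "all_distinct xs"
  then have 1: "length (filter (\<lambda>y. y = x) xs) = 1" if "x \<in> set xs" for x
  proof -
    have "case filter (\<lambda>y. y = x) xs of [] \<Rightarrow> False | y # ys \<Rightarrow> (case ys of [] \<Rightarrow> True | _ # _ \<Rightarrow> False)"
      using \<open>all_distinct xs\<close> that by (simp add: all_distinct_def list_all_iff)
    then show ?thesis by (auto split: list.splits)
  qed
  show "distinct xs"
  proof (rule ccontr)
    assume "\<not> distinct xs"
    then obtain as bs cs y where "xs = as @ [y] @ bs @ [y] @ cs" using not_distinct_decomp by blast
    then show False using 1[of y] by simp
  qed
next
  assume "distinct xs"
  then have "filter (\<lambda>y. y = x) xs = [x]" if "x \<in> set xs" for x
    using that by (induction xs) (auto simp: filter_empty_conv)
  then show "all_distinct xs" by (simp add: all_distinct_def list_all_iff)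
qed

lemma fp_all_distinct: "fp X \<Longrightarrow> fp (\<lambda>e. all_distinct (X e))"
proof (erule fp_comp)
  show "fp all_distinct"
    unfolding all_distinct_def[abs_def]
    by (intro fp_list_all fp_case_list fp_filter fp_eq fp_const fp_fst fp_snd fp_id)
qed

lemma fp_comes_first:
  assumes "fp v" "fp c" "fp d"
  shows "fp (\<lambda>e. comes_first (v e) (c e) (d e))"
proof -
  have "fp (\<lambda>t. comes_first (fst t) (fst (snd t)) (snd (snd t)))"
    unfolding comes_first_def
    by (intro fp_case_list fp_filter fp_eq fp_disj fp_const fp_fst fp_snd fp_id)
  from fp_comp[OF fp_Pair[OF assms(1) fp_Pair[OF assms(2,3)]] this] show ?thesis by simp
qed

lemma fp_weighted_support:
  assumes "fp W" "fp c" "fp d"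
  shows "fp (\<lambda>e. weighted_support (W e) (c e) (d e))"
proof -
  have "fp (\<lambda>t. weighted_support (fst t) (fst (snd t)) (snd (snd t)))"
    unfolding weighted_support_def
    by (intro fp_sum fp_If fp_comes_first fp_const fp_fst fp_snd fp_id)
  from fp_comp[OF fp_Pair[OF assms(1) fp_Pair[OF assms(2,3)]] this] show ?thesis by simp
qed

text \<open>A support matrix is a function and has no code. The input is therefore the list of
  weighted votes, from which entries are computed on demand.\<close>

definition fp_comparison :: "comparison \<Rightarrow> bool" where
  "fp_comparison beats \<longleftrightarrow>
     fp (\<lambda>t. beats (weighted_support (fst t)) (fst (snd t)) (fst (snd (snd t))) (snd (snd (snd t))))"

lemma fp_borda_beats: "fp_comparison borda_beats"
  unfolding fp_comparison_def borda_beats_def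
  by (intro fp_less fp_sum fp_weighted_support fp_filter fp_not fp_eq fp_fst fp_snd fp_id)

lemma fp_copeland_beats: "fp_comparison copeland_beats"
  unfolding fp_comparison_def copeland_beats_def
  by (intro fp_less fp_add fp_sum fp_If fp_weighted_support fp_filter fp_not fp_eq fp_const fp_fst fp_snd fp_id)

lemma fp_maximin_beats: "fp_comparison maximin_beats"
  unfolding fp_comparison_def maximin_beats_def
  by (intro fp_less fp_list_ex fp_list_all fp_conj fp_disj fp_weighted_support fp_not fp_eq fp_fst fp_snd fp_id)

definition check_vote :: "cand list \<Rightarrow> vote \<Rightarrow> bool" where
  "check_vote cs v \<longleftrightarrow> all_distinct v \<and> list_all (\<lambda>x. member x cs) v \<and> list_all (\<lambda>x. member x v) cs"

lemma check_vote_iff: "check_vote cs v \<longleftrightarrow> is_vote (set cs) v"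
  by (auto simp: check_vote_def is_vote_def all_distinct_iff member_iff list_all_iff)

lemma fp_check_vote:
  assumes "fp cs" "fp v"
  shows "fp (\<lambda>e. check_vote (cs e) (v e))"
proof -
  have "fp (\<lambda>t. check_vote (fst t) (snd t))"
    unfolding check_vote_def
    by (intro fp_conj fp_all_distinct fp_list_all fp_member fp_fst fp_snd fp_id)
  then show ?thesis by (rule fp_comp2[OF _ assms])
qed

type_synonym raw_instance = "cand list \<times> (vote \<times> nat) list \<times> nat list \<times> cand"

definition check_instance :: "comparison \<Rightarrow> raw_instance \<Rightarrow> bool" where
  "check_instance beats t \<longleftrightarrow>
     all_distinct (fst t) \<and> member (snd (snd (snd t))) (fst t) \<and>
     list_all (\<lambda>x. check_vote (fst t) (fst x)) (fst (snd t)) \<and>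
     beatable beats (fst t) (fst (snd t)) (fst (snd (snd t))) (snd (snd (snd t)))"

lemma fp_check_instance:
  assumes "fp_comparison beats"
  shows "fp (check_instance beats)"
proof -
  have beats: "fp (\<lambda>e. beats (weighted_support (W e)) (cs e) (c e) (h e))"
    if "fp W" "fp cs" "fp c" "fp h" for W cs c and h :: "'e::encodable \<Rightarrow> cand"
    using fp_comp[OF fp_Pair[OF that(1) fp_Pair[OF that(2) fp_Pair[OF that(3,4)]]]
        assms[unfolded fp_comparison_def]] by simp
  show ?thesis
    unfolding check_instance_def[abs_def] beatable_def best_vote_def
    by (intro fp_conj fp_all_distinct fp_member fp_list_all fp_list_ex fp_check_vote fp_not fp_eq beats
        fp_append fp_map fp_Pair fp_Cons fp_filter fp_const fp_fst fp_snd fp_id)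
qed

definition parse_instance :: "bool list \<Rightarrow> (raw_instance \<times> bool list) list" where
  "parse_instance =
     parse_pair (parse_list parse_nat)
       (parse_pair (parse_list (parse_pair (parse_list parse_nat) parse_nat))
         (parse_pair (parse_list parse_nat) parse_nat))"

definition to_raw :: "dcwm_instance \<Rightarrow> raw_instance" where
  "to_raw I = (cands I, cast_votes I, open_weights I, target I)"

definition of_raw :: "raw_instance \<Rightarrow> dcwm_instance" where
  "of_raw t = \<lparr>cands = fst t, cast_votes = fst (snd t), open_weights = fst (snd (snd t)),
     target = snd (snd (snd t))\<rparr>"

lemma to_raw_of_raw: "to_raw (of_raw t) = t"
  by (simp add: to_raw_def of_raw_def)

lemma of_raw_to_raw: "of_raw (to_raw I) = I"
  by (simp add: to_raw_def of_raw_def)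

lemma parses_instance: "parses parse_instance (\<lambda>t. enc_instance (of_raw t))"
proof -
  have vote: "parses (parse_pair (parse_list parse_nat) parse_nat) enc_weighted_vote"
    using parses_pair[OF parses_list[OF parses_nat] parses_nat]
    unfolding enc_weighted_vote_def[abs_def] .
  show ?thesis
    using parses_pair[OF parses_list[OF parses_nat] parses_pair[OF parses_list[OF vote]
        parses_pair[OF parses_list[OF parses_nat] parses_nat]]]
    unfolding parse_instance_def enc_instance_def of_raw_def by simp
qed

lemma check_instance_iff:
  assumes "expresses beats score" "monotone_comparison beats"
  shows "check_instance beats (to_raw I) \<longleftrightarrow> wf_instance I \<and> manipulable score I"
proof -
  have "wf_instance I \<longleftrightarrow> all_distinct (cands I) \<and> member (target I) (cands I) \<and>
      list_all (\<lambda>x. check_vote (cands I) (fst x)) (cast_votes I)"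
    by (auto simp: wf_instance_def all_distinct_iff member_iff check_vote_iff list_all_iff)
  then show ?thesis
    using manipulable_iff_beatable[OF assms] by (auto simp: check_instance_def to_raw_def)
qed

lemma DCWM_in_class_P:
  assumes "expresses beats score" "monotone_comparison beats" "fp_comparison beats"
  shows "DCWM score \<in> class_P"
proof -
  \<comment> \<open>An encoding uses up the whole string, so a nonempty remainder after the instance
    means rejection.\<close>
  define D where "D x = (case parse_instance x of [] \<Rightarrow> False | y # _ \<Rightarrow>
    (case snd y of [] \<Rightarrow> check_instance beats (fst y) | _ # _ \<Rightarrow> False))" for x
  note p = parsesD[OF parses_instance]
  have "fp D"
    unfolding D_def
    by (rule fp_case_list[OF p(1) fp_const]) (intro fp_case_list fp_comp[OF _ fp_check_instance[OF assms(3)]]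
        fp_const fp_fst fp_snd fp_id)
  moreover have "DCWM score = {x. D x}"
  proof (intro set_eqI iffI)
    fix x assume "x \<in> DCWM score"
    then obtain I where I: "x = enc_instance I" "wf_instance I" "manipulable score I"
      by (auto simp: DCWM_def)
    have "parse_instance x = [(to_raw I, [])]"
      using p(2)[of "to_raw I" "[]"] by (simp add: I(1) of_raw_to_raw)
    then show "x \<in> {x. D x}" using I check_instance_iff[OF assms(1,2)] by (simp add: D_def)
  next
    fix x assume "x \<in> {x. D x}"
    then obtain t where t: "parse_instance x = [(t, [])]" "check_instance beats t" "x = enc_instance (of_raw t)"
      using p(4)[of x] by (auto simp: D_def split: list.splits)
    have "wf_instance (of_raw t) \<and> manipulable score (of_raw t)"
      using check_instance_iff[OF assms(1,2), of "of_raw t"] t(2) by (simp add: to_raw_of_raw)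
    with t(3) show "x \<in> DCWM score" by (auto simp: DCWM_def)
  qed
  ultimately show ?thesis using fp_class_P by simp
qed

theorem corollary1:
  shows "DCWM borda \<in> class_P \<and> DCWM copeland \<in> class_P \<and> DCWM maximin \<in> class_P"
  using DCWM_in_class_P[OF expresses_borda monotone_borda fp_borda_beats]
    DCWM_in_class_P[OF expresses_copeland monotone_copeland fp_copeland_beats]
    DCWM_in_class_P[OF expresses_maximin monotone_maximin fp_maximin_beats]
  by blast

end
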